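(* Let $m,n\in\mathbb{N}$ with $m\geq 3$ and let $A\in M_n$. Then $$d(\mathcal{K}_m(A))=i_{\geq 0}(\mathrm{Re}(\mathcal{K}_m(A)))=i_{\geq 0}\bigl(2\,\mathrm{Re}(J_m(0)\otimes A)-2(I_{m-1}\oplus[0])\otimes AA^*\bigr).$$ If $A$ is nonsingular, then $$d(\mathcal{K}_m(A))=n+i_{\geq 0}\bigl(2\,\mathrm{Re}(J_{m-2}(0)\otimes A)-2(I_{m-2}\otimes AA^* )\bigr).$$
   Context: $M_n$ is the set of $n\times n$ complex matrices. For $A\in M_n$ and $m\ge 2$, the block upper triangular KMS matrix $\mathcal{K}_m(A)$ is the $mn\times mn$ matrix whose $(i,j)$ block ($n\times n$, $1\le i,j\le m$) is $A^{j-i}$ if $j>i$ and $0$ if $j\le i$. The zero-dilation index $d(X)$ of a square complex matrix $X$ is the largest integer $k$ such that $X$ is unitarily similar to a matrix of the form $\begin{bmatrix}0_k & *\\ * & *\end{bmatrix}$, where $0_k$ is the $k\times k$ zero matrix ($k=0$ if there is no such positive $k$). $\mathrm{Re}(X)=(X+X^* )/2$ where $X^*$ is the conjugate transpose; $i_{\geq 0}(H)$ is the number of nonnegative eigenvalues, counted with multiplicity, of a Hermitian matrix $H$. $J_k(0)$ is the $k\times k$ upper triangular nilpotent Jordan block ($J_1(0)=[0]$), $X\otimes Y=[x_{ij}Y]$ is the Kronecker product and $\oplus$ is the direct sum. *)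

theory Defs
  imports
    "Jordan_Normal_Form.Schur_Decomposition"
    "Jordan_Normal_Form.Jordan_Normal_Form"
begin

text \<open>Kronecker product \<open>X \<otimes> Y = [x\<^sub>i\<^sub>j Y]\<close>.\<close>

definition kron :: "complex mat \<Rightarrow> complex mat \<Rightarrow> complex mat" where
  "kron X Y = mat (dim_row X * dim_row Y) (dim_col X * dim_col Y)
     (\<lambda>(p, q). X $$ (p div dim_row Y, q div dim_col Y) * Y $$ (p mod dim_row Y, q mod dim_col Y))"

text \<open>For \<open>A\<close> of size \<open>n \<times> n\<close>, the entry \<open>(p, q)\<close> lies in the (zero-based) block
  \<open>(p div n, q div n)\<close> at position \<open>(p mod n, q mod n)\<close>.\<close>

definition kms :: "nat \<Rightarrow> complex mat \<Rightarrow> complex mat" where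
  "kms m A = (let n = dim_row A in
     mat (m * n) (m * n) (\<lambda>(p, q).
       if p div n < q div n then (A ^\<^sub>m (q div n - p div n)) $$ (p mod n, q mod n) else 0))"

definition re_mat :: "complex mat \<Rightarrow> complex mat" where
  "re_mat X = (1 / 2) \<cdot>\<^sub>m (X + mat_adjoint X)"

text \<open>Multiplicity is the algebraic one; for Hermitian matrices, the only intended
  arguments, all eigenvalues are real and both multiplicities agree.\<close>

definition num_nonneg_eigenvalues :: "complex mat \<Rightarrow> nat" where
  "num_nonneg_eigenvalues H =
     (\<Sum>x | 0 \<le> x \<and> eigenvalue H (complex_of_real x). order (complex_of_real x) (char_poly H))"

definition unitary_mat :: "complex mat \<Rightarrow> bool" where
  "unitary_mat U \<longleftrightarrow> square_mat U \<and> mat_adjoint U * U = 1\<^sub>m (dim_row U)"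

definition unitarily_similar :: "complex mat \<Rightarrow> complex mat \<Rightarrow> bool" where
  "unitarily_similar X Y \<longleftrightarrow>
     (\<exists>U. unitary_mat U \<and> dim_row U = dim_row X \<and> Y = mat_adjoint U * X * U)"

text \<open>The complementary size \<open>r\<close> may be \<open>0\<close>, so \<open>k\<close> can be the full size of \<open>Y\<close>.\<close>

definition has_leading_zero_block :: "nat \<Rightarrow> complex mat \<Rightarrow> bool" where
  "has_leading_zero_block k Y \<longleftrightarrow>
     (\<exists>r B C D. B \<in> carrier_mat k r \<and> C \<in> carrier_mat r k \<and> D \<in> carrier_mat r r \<and>
        Y = four_block_mat (0\<^sub>m k k) B C D)"

definition zero_dilation_index :: "complex mat \<Rightarrow> nat" where
  "zero_dilation_index X = Max {k. \<exists>Y. unitarily_similar X Y \<and> has_leading_zero_block k Y}"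

text \<open>For square \<open>X\<close> the maximum is taken over a finite set containing \<open>0\<close>.\<close>

lemma zero_dilation_set_finite:
  "finite {k. \<exists>Y. unitarily_similar X Y \<and> has_leading_zero_block k Y}"
proof (rule finite_subset)
  show "{k. \<exists>Y. unitarily_similar X Y \<and> has_leading_zero_block k Y} \<subseteq> {..dim_row X}"
  proof clarsimp
    fix k Y assume "unitarily_similar X Y" and k: "has_leading_zero_block k Y"
    then obtain U where U: "dim_row U = dim_row X" "square_mat U" "Y = mat_adjoint U * X * U"
      unfolding unitarily_similar_def unitary_mat_def by auto
    have "dim_row Y = dim_row X" using U by (simp add: mat_adjoint_def)
    moreover have "k \<le> dim_row Y"
      using k unfolding has_leading_zero_block_def by auto
    ultimately show "k \<le> dim_row X" by simp
  qed
qed simp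

lemma zero_dilation_set_zero:
  assumes X: "X \<in> carrier_mat n n"
  shows "0 \<in> {k. \<exists>Y. unitarily_similar X Y \<and> has_leading_zero_block k Y}"
proof -
  have adj: "mat_adjoint (1\<^sub>m n) = (1\<^sub>m n :: complex mat)"
    by (rule eq_matI) (auto simp: mat_adjoint_def mat_of_rows_index)
  have "unitarily_similar X X"
    unfolding unitarily_similar_def unitary_mat_def
    by (rule exI[of _ "1\<^sub>m n"]) (use X adj in auto)
  moreover have "has_leading_zero_block 0 X"
    unfolding has_leading_zero_block_def
    by (rule exI[of _ n], rule exI[of _ "0\<^sub>m 0 n"], rule exI[of _ "0\<^sub>m n 0"], rule exI[of _ X])
      (use X in \<open>auto intro!: eq_matI\<close>)
  ultimately show ?thesis by auto
qed

end

theory Submission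
  imports Defs "Jordan_Normal_Form.Spectral_Radius" "HOL-Library.Function_Algebras"
begin

text \<open>
  Put \<open>T = J\<^sub>m(0) \<otimes> A\<close>. Since \<open>kms m A = T (1 - T)\<^sup>-\<^sup>1\<close>, congruence by \<open>1 - T\<close> carries \<open>kms m A\<close> to
  \<open>M = T - T T*\<close> and twice its real part to \<open>H = T + T* - 2 T T*\<close>. The zero-dilation index of a
  matrix is the largest dimension of an isotropic subspace, and the number of nonnegative eigenvalues
  of a Hermitian matrix is the largest dimension of a subspace on which its form is nonnegative; both
  are congruence invariants. An isotropic subspace of \<open>M\<close> is nonnegative for \<open>H\<close>, so it remains to turn
  a nonnegative subspace of \<open>H\<close> into an isotropic subspace of \<open>M\<close> of the same dimension.

  The kernel of \<open>T*\<close> is \<open>H\<close>-isotropic, which reduces the question to the orthogonal complement \<open>L\<close> of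
  \<open>ker T* + T (ker T*)\<close>, where \<open>T T*\<close> is positive definite. Diagonalize \<open>T + T*\<close> on \<open>L\<close> relative to
  \<open>T T*\<close>. A basis vector \<open>v\<close> whose ratio \<open>\<mu>\<close> is at least \<open>2\<close> is rescaled by the factor \<open>z\<^sup>d\<close> on the block of index
  \<open>d\<close>, where \<open>z + 1 / z = \<mu>\<close> and \<open>z \<ge> 1\<close>. As \<open>T\<close> shifts the block index by one, the rescaled vector \<open>y\<close>
  satisfies \<open>M y = - z\<^sup>2 M* y\<close> on \<open>L\<close>, and these vectors are independent and span, together with \<open>ker T*\<close>,
  an isotropic subspace of \<open>M\<close>. If \<open>A\<close> is nonsingular then \<open>ker T*\<close> is the last block, \<open>L\<close> consists of the
  first \<open>m - 2\<close> blocks, and the reduction to \<open>L\<close> gives the second formula.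
\<close>

section \<open>Hermitian forms on finite-dimensional subspaces\<close>

locale complex_vector_space = vector_space scale
  for scale :: "complex \<Rightarrow> 'v::ab_group_add \<Rightarrow> 'v" (infixr \<open>*s\<close> 75)
begin

text \<open>A property of sets, because the ambient space used later,
  \<open>nat \<Rightarrow> complex\<close>, is infinite-dimensional. It guards against
  infinite-dimensional sets, for which \<open>dim\<close> is \<open>0\<close> by convention.\<close>

definition finite_dim :: "'v set \<Rightarrow> bool" where
  "finite_dim S \<longleftrightarrow> (\<exists>B. finite B \<and> S \<subseteq> span B)"

lemma finite_dim_subset: "finite_dim T \<Longrightarrow> S \<subseteq> T \<Longrightarrow> finite_dim S"
  unfolding finite_dim_def by blast

lemma finite_dim_span: "finite B \<Longrightarrow> finite_dim (span B)"
  unfolding finite_dim_def by blast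

lemma finite_dim_span_insert:
  assumes "finite_dim S" shows "finite_dim (span (insert x S))"
proof -
  obtain B where B: "finite B" "S \<subseteq> span B"
    using assms unfolding finite_dim_def by blast
  have "insert x S \<subseteq> span (insert x B)"
    using B(2) span_mono[of B "insert x B"] span_base[of x "insert x B"] by blast
  then have "span (insert x S) \<subseteq> span (insert x B)"
    by (rule span_minimal) (rule subspace_span)
  then show ?thesis using B(1) unfolding finite_dim_def by blast
qed

lemma subspace_basis:
  assumes "subspace S" "finite_dim S"
  obtains B where "finite B" "independent B" "B \<subseteq> S" "span B = S" "card B = dim S"
proof -
  obtain B where B: "B \<subseteq> S" "independent B" "S \<subseteq> span B"
    using maximal_independent_subset[of S] by blast
  obtain C where C: "finite C" "S \<subseteq> span C"
    using assms(2) unfolding finite_dim_def by blast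
  have "finite B"
    using independent_span_bound[OF C(1) B(2)] B(1) C(2) by blast
  moreover have "span B = S"
    using B assms(1) by (metis span_minimal subset_antisym)
  moreover have "card B = dim S"
    using basis_card_eq_dim B by blast
  ultimately show ?thesis using B that by blast
qed

lemma independent_card_le_dim_of_finite_dim:
  assumes "finite_dim T" "S \<subseteq> T" "independent S"
  shows "card S \<le> dim T"
proof -
  obtain B where B: "B \<subseteq> T" "independent B" "T \<subseteq> span B"
    using maximal_independent_subset[of T] by blast
  obtain C where C: "finite C" "T \<subseteq> span C"
    using assms(1) unfolding finite_dim_def by blast
  have fB: "finite B"
    using independent_span_bound[OF C(1) B(2)] B(1) C(2) by blast
  have "card S \<le> card B"
    using independent_span_bound[OF fB assms(3)] assms(2) B(3) by blast
  then show ?thesis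
    using basis_card_eq_dim B by metis
qed

lemma dim_mono_finite_dim:
  assumes "finite_dim T" "S \<subseteq> T"
  shows "dim S \<le> dim T"
proof -
  obtain B where B: "B \<subseteq> S" "independent B" "S \<subseteq> span B"
    using maximal_independent_subset[of S] by blast
  have "card B \<le> dim T"
    using independent_card_le_dim_of_finite_dim[OF assms(1) _ B(2)] B(1) assms(2) by blast
  then show ?thesis using basis_card_eq_dim B by metis
qed

lemma dim_pos_nonzero:
  assumes "0 < dim S" shows "\<exists>x\<in>S. x \<noteq> 0"
proof (rule ccontr)
  assume "\<not> ?thesis"
  then have "S \<subseteq> span {}" by auto
  then have "dim S \<le> card ({} :: 'v set)" by (rule dim_le_card) simp
  with assms show False by simp
qed

lemma dim_span_insert:
  assumes "subspace S" "finite_dim S" "x \<notin> S"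
  shows "dim (span (insert x S)) = dim S + 1"
proof -
  obtain B where B: "finite B" "independent B" "B \<subseteq> S" "span B = S" "card B = dim S"
    using subspace_basis[OF assms(1,2)] .
  have "independent (insert x B)"
    using B assms(3) by (intro independent_insertI) auto
  moreover have "span (insert x S) = span (insert x B)"
    by (metis B(4) span_insert span_span)
  moreover have "x \<notin> B" using B(3) assms(3) by blast
  ultimately show ?thesis
    using B by (simp add: dim_eq_card_independent)
qed

lemma subspace_functional_kernel:
  assumes S: "subspace S"
    and add: "\<And>x y. \<phi> (x + y) = \<phi> x + \<phi> y" and scl: "\<And>c x. \<phi> (scale c x) = c * \<phi> x"
  shows "subspace {x\<in>S. \<phi> x = (0::complex)}"
proof (rule subspaceI)
  have "\<phi> 0 = 0" using scl[of 0 0] by simp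
  then show "0 \<in> {x\<in>S. \<phi> x = 0}" using subspace_0[OF S] by simp
qed (use assms subspace_add[OF S] subspace_scale[OF S] in auto)

text \<open>If \<open>\<phi> s \<noteq> 0\<close> for some \<open>s\<close> in \<open>S\<close>,
  subtracting the multiple \<open>\<phi> x / \<phi> s\<close> of \<open>s\<close> moves every
  \<open>x\<close> into the kernel, so \<open>s\<close> and a basis of the kernel together span
  \<open>S\<close>.\<close>

lemma dim_functional_kernel:
  assumes S: "subspace S" "finite_dim S"
    and add: "\<And>x y. \<phi> (x + y) = \<phi> x + \<phi> y" and scl: "\<And>c x. \<phi> (scale c x) = c * \<phi> x"
  shows "dim S \<le> dim {x\<in>S. \<phi> x = (0::complex)} + 1"
proof (cases "\<exists>s\<in>S. \<phi> s \<noteq> 0")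
  case False
  then have "{x\<in>S. \<phi> x = (0::complex)} = S" by auto
  then show ?thesis by simp
next
  case True
  then obtain s where s: "s \<in> S" "\<phi> s \<noteq> 0" by blast
  let ?T = "{x\<in>S. \<phi> x = (0::complex)}"
  have subT: "subspace ?T" by (rule subspace_functional_kernel) (use assms in auto)
  obtain B where B: "finite B" "independent B" "B \<subseteq> ?T" "span B = ?T" "card B = dim ?T"
    using subspace_basis[OF subT finite_dim_subset[OF S(2)]] by blast
  have "S \<subseteq> span (insert s B)"
  proof
    fix x assume x: "x \<in> S"
    have "\<phi> (x - scale (\<phi> x / \<phi> s) s) = 0"
      using add[of x "scale (- (\<phi> x / \<phi> s)) s"] scl[of "- (\<phi> x / \<phi> s)" s] s(2) by simp
    moreover have "x - scale (\<phi> x / \<phi> s) s \<in> S"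
      using x s S(1) by (simp add: subspace_diff subspace_scale)
    ultimately have "x - scale (\<phi> x / \<phi> s) s \<in> span B" using B(4) by simp
    then show "x \<in> span (insert s B)" unfolding span_insert by blast
  qed
  then have "dim S \<le> card (insert s B)" by (rule dim_le_card) (use B in simp)
  also have "\<dots> \<le> dim ?T + 1" using B(1,5) by (simp add: card_insert_if)
  finally show ?thesis .
qed

text \<open>Each functional costs at most one dimension. Intersections with orthogonal complements
  are counted this way below.\<close>

lemma dim_functionals_kernel:
  assumes "finite I" and S: "subspace S" "finite_dim S"
    and add: "\<And>i x y. i \<in> I \<Longrightarrow> \<phi> i (x + y) = \<phi> i x + \<phi> i y"
    and scl: "\<And>i c x. i \<in> I \<Longrightarrow> \<phi> i (scale c x) = c * \<phi> i x"
  shows "subspace {x\<in>S. \<forall>i\<in>I. \<phi> i x = (0::complex)} \<and>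
         dim S \<le> dim {x\<in>S. \<forall>i\<in>I. \<phi> i x = (0::complex)} + card I"
  using assms(1) add scl
proof (induction I rule: finite_induct)
  case empty
  then show ?case using S by simp
next
  case (insert j J)
  let ?T = "{x\<in>S. \<forall>i\<in>J. \<phi> i x = (0::complex)}"
  have IH: "subspace ?T \<and> dim S \<le> dim ?T + card J"
    by (rule insert.IH) (use insert.prems in auto)
  have eq: "{x\<in>S. \<forall>i\<in>insert j J. \<phi> i x = (0::complex)} = {x\<in>?T. \<phi> j x = 0}" by auto
  have fd: "finite_dim ?T" by (rule finite_dim_subset[OF S(2)]) auto
  have "subspace {x\<in>?T. \<phi> j x = 0}"
    by (rule subspace_functional_kernel) (use IH insert.prems in auto)
  moreover have "dim ?T \<le> dim {x\<in>?T. \<phi> j x = 0} + 1"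
    by (rule dim_functional_kernel) (use IH fd insert.prems in auto)
  ultimately show ?case unfolding eq using IH insert.hyps by auto
qed

lemma subspace_image_dim:
  assumes S: "subspace S" "finite_dim S" and f: "Vector_Spaces.linear scale scale f" and inj: "inj_on f S"
  shows "subspace (f ` S)" "finite_dim (f ` S)" "dim (f ` S) = dim S"
proof -
  interpret f: Vector_Spaces.linear scale scale f by fact
  interpret pp: vector_space_pair scale scale ..
  obtain B where B: "finite B" "independent B" "B \<subseteq> S" "span B = S" "card B = dim S"
    using subspace_basis[OF S] .
  have sp: "span (f ` B) = f ` S" using f.span_image[of B] B(4) by simp
  show "subspace (f ` S)" using sp subspace_span by metis
  show "finite_dim (f ` S)" using sp B(1) finite_dim_span by (metis finite_imageI)
  have "independent (f ` B)"
    by (rule pp.linear_independent_injective_image[OF f B(2)]) (use inj B(4) in simp)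
  then have "dim (span (f ` B)) = card (f ` B)"
    by (simp add: dim_eq_card_independent)
  also have "\<dots> = card B" by (rule card_image) (use inj B(3) inj_on_subset in blast)
  finally show "dim (f ` S) = dim S" using sp B(5) by simp
qed


section \<open>Hermitian forms and their isotropic vectors\<close>

definition hermitian_form :: "('v \<Rightarrow> 'v \<Rightarrow> complex) \<Rightarrow> bool" where
  "hermitian_form h \<longleftrightarrow> (\<forall>x y z. h x (y + z) = h x y + h x z) \<and>
     (\<forall>c x y. h x (c *s y) = c * h x y) \<and> (\<forall>x y. h y x = cnj (h x y))"

definition nonneg_on :: "('v \<Rightarrow> 'v \<Rightarrow> complex) \<Rightarrow> 'v set \<Rightarrow> bool" where
  "nonneg_on h S \<longleftrightarrow> (\<forall>x\<in>S. 0 \<le> Re (h x x))"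

definition pos_def_on :: "('v \<Rightarrow> 'v \<Rightarrow> complex) \<Rightarrow> 'v set \<Rightarrow> bool" where
  "pos_def_on h S \<longleftrightarrow> (\<forall>x\<in>S. x \<noteq> 0 \<longrightarrow> 0 < Re (h x x))"

context
  fixes h assumes h: "hermitian_form h"
begin

lemma form_add_right: "h x (y + z) = h x y + h x z"
  and form_scale_right: "h x (c *s y) = c * h x y"
  and form_cnj: "h y x = cnj (h x y)"
  using h unfolding hermitian_form_def by blast+

lemma form_add_left: "h (x + y) z = h x z + h y z"
proof -
  have "h (x + y) z = cnj (h z x + h z y)" by (metis form_cnj form_add_right)
  also have "\<dots> = h x z + h y z" by (metis complex_cnj_add form_cnj)
  finally show ?thesis .
qed

lemma form_scale_left: "h (c *s x) z = cnj c * h x z"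
  by (metis complex_cnj_mult form_cnj form_scale_right)

lemma form_zero_right [simp]: "h x 0 = 0"
  using form_scale_right[of x 0 0] by simp

lemma form_zero_left [simp]: "h 0 x = 0"
  using form_scale_left[of 0 0 x] by simp

lemma form_sum_right: "h x (\<Sum>i\<in>I. f i) = (\<Sum>i\<in>I. h x (f i))"
  by (induction I rule: infinite_finite_induct) (auto simp: form_add_right)

lemma form_diag_real: "h x x = complex_of_real (Re (h x x))"
  using arg_cong[OF form_cnj[of x x], of Im] by (simp add: complex_eq_iff)

text \<open>Degenerate Cauchy-Schwarz: since \<open>h x x = 0\<close>, the form at
  \<open>y + c *s x\<close> is affine in \<open>c\<close> over the reals, and if
  \<open>h x y \<noteq> 0\<close> a suitable \<open>c\<close> makes it negative.\<close>

lemma nonneg_isotropic_orthogonal: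
  assumes S: "subspace S" and nn: "nonneg_on h S" and x: "x \<in> S" "h x x = 0" and y: "y \<in> S"
  shows "h x y = 0"
proof (rule ccontr)
  assume ne: "h x y \<noteq> 0"
  \<comment> \<open>Chosen so that the form at \<open>y + c *s x\<close> has real part
    \<open>Re (h y y) - (Re (h y y) + 1) = -1\<close>.\<close>
  define s where "s = (Re (h y y) + 1) / (2 * (cmod (h x y))\<^sup>2)"
  define c where "c = - complex_of_real s * h x y"
  have "y + c *s x \<in> S" using S x y by (simp add: subspace_add subspace_scale)
  then have "0 \<le> Re (h (y + c *s x) (y + c *s x))" using nn unfolding nonneg_on_def by blast
  also have "h (y + c *s x) (y + c *s x) = h y y + c * h y x + cnj c * h x y"
    using x(2) by (simp add: form_add_left form_add_right form_scale_left form_scale_right)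
  also have "c * h y x = - complex_of_real (s * (cmod (h x y))\<^sup>2)"
    unfolding c_def form_cnj[where x = x and y = y] using complex_norm_square[of "h x y"]
    by (simp add: mult.assoc)
  also have "cnj c * h x y = - complex_of_real (s * (cmod (h x y))\<^sup>2)"
    unfolding c_def using complex_norm_square[of "h x y"]
    by (simp add: mult.assoc mult.commute[of "cnj (h x y)"])
  also have "Re (h y y + - complex_of_real (s * (cmod (h x y))\<^sup>2) +
      - complex_of_real (s * (cmod (h x y))\<^sup>2)) = Re (h y y) - 2 * (s * (cmod (h x y))\<^sup>2)"
    by simp
  also have "2 * (s * (cmod (h x y))\<^sup>2) = Re (h y y) + 1"
    using ne unfolding s_def by simp
  finally show False by simp
qed

text \<open>The vectors of a basis of \<open>K\<close> are absorbed one at a time. If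
  \<open>x\<close> is not yet in \<open>T\<close>, then \<open>T\<close> is cut down to the vectors
  \<open>h\<close>-orthogonal to \<open>x\<close>, which loses at most one dimension, and
  \<open>x\<close> is adjoined, which regains it. The form at \<open>t + c *s x\<close> is still
  \<open>h t t\<close>, and vectors absorbed earlier survive the cut because \<open>K\<close> is
  totally isotropic.\<close>

lemma nonneg_absorb_isotropic:
  assumes S: "subspace S" "finite_dim S" and nn: "nonneg_on h S"
    and K: "subspace K" "finite_dim K" and iso: "\<And>x y. x \<in> K \<Longrightarrow> y \<in> K \<Longrightarrow> h x y = 0"
  obtains T where "subspace T" "finite_dim T" "nonneg_on h T" "K \<subseteq> T" "dim S \<le> dim T"
    "T \<subseteq> span (S \<union> K)"
proof -
  obtain B where B: "finite B" "independent B" "B \<subseteq> K" "span B = K" "card B = dim K"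
    using subspace_basis[OF K] .
  have "C \<subseteq> K \<Longrightarrow> \<exists>T. subspace T \<and> finite_dim T \<and> nonneg_on h T \<and> C \<subseteq> T \<and> dim S \<le> dim T
    \<and> T \<subseteq> span (S \<union> K)" if "finite C" for C
    using that
  proof (induction C rule: finite_induct)
    case empty
    show ?case by (rule exI[of _ S]) (use assms span_superset[of "S \<union> K"] in auto)
  next
    case (insert x C)
    then obtain T where T: "subspace T" "finite_dim T" "nonneg_on h T" "C \<subseteq> T" "dim S \<le> dim T"
       "T \<subseteq> span (S \<union> K)" by auto
    show ?case
    proof (cases "x \<in> T")
      case True
      then show ?thesis using T by blast
    next
      case False
      let ?T0 = "{t\<in>T. h x t = 0}"
      let ?T1 = "span (insert x ?T0)"
      have xx: "h x x = 0" using iso insert.prems by blast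
      have sub0: "subspace ?T0"
        by (rule subspace_functional_kernel) (auto simp: T form_add_right form_scale_right)
      have fd0: "finite_dim ?T0" by (rule finite_dim_subset[OF T(2)]) auto
      have "dim T \<le> dim ?T0 + 1"
        by (rule dim_functional_kernel) (auto simp: T form_add_right form_scale_right)
      moreover have "dim ?T1 = dim ?T0 + 1"
        by (rule dim_span_insert) (use sub0 fd0 False in auto)
      moreover have "nonneg_on h ?T1"
        unfolding nonneg_on_def
      proof
        fix y assume "y \<in> ?T1"
        then obtain c where c: "y - c *s x \<in> ?T0"
          unfolding span_insert using sub0 by (auto simp: span_eq_iff[THEN iffD2])
        define t where "t = y - c *s x"
        have t: "t \<in> T" "h x t = 0" "h t x = 0" and y: "y = t + c *s x"
          using c form_cnj[of t x] unfolding t_def by auto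
        have "h y y = h t t"
          unfolding y using t xx
          by (simp add: form_add_left form_add_right form_scale_left form_scale_right)
        then show "0 \<le> Re (h y y)" using T(3) t(1) unfolding nonneg_on_def by simp
      qed
      moreover have "insert x C \<subseteq> ?T1"
      proof -
        have "C \<subseteq> ?T0" using T(4) insert.prems iso by auto
        then show ?thesis using span_superset[of "insert x ?T0"] by auto
      qed
      moreover have "?T1 \<subseteq> span (S \<union> K)"
        by (rule span_minimal) (use T(6) insert.prems span_superset[of "S \<union> K"] subspace_span in auto)
      ultimately show ?thesis using T(5) finite_dim_span_insert[OF fd0] subspace_span
        by (intro exI[of _ ?T1]) auto
    qed
  qed
  from this[OF B(1,3)] obtain T where T: "subspace T" "finite_dim T" "nonneg_on h T" "B \<subseteq> T" "dim S \<le> dim T"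
       "T \<subseteq> span (S \<union> K)" by blast
  moreover have "K \<subseteq> T" using T(1,4) B(4) span_minimal by blast
  ultimately show ?thesis using that by blast
qed

end

end

lemma obtain_mat_inverse:
  fixes A :: "'a::field mat"
  assumes A: "A \<in> carrier_mat n n" and nz: "det A \<noteq> 0"
  obtains B where "B \<in> carrier_mat n n" "A * B = 1\<^sub>m n" "B * A = 1\<^sub>m n"
  using det_non_zero_imp_unit[OF A nz, of "()"]
  unfolding Units_def by (auto simp: ring_mat_def)

context complex_vector_space
begin

section \<open>Simultaneous diagonalization and inertia\<close>

lemma form_eq_on_span:
  assumes b: "hermitian_form b" and g: "hermitian_form g"
    and eq: "\<And>u. u \<in> B \<Longrightarrow> b u v = c * g u v" and x: "x \<in> span B"
  shows "b x v = c * g x v"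
  using x
proof (induction rule: span_induct_alt)
  case base
  show ?case by (simp add: form_zero_left[OF b] form_zero_left[OF g])
next
  case (step a u y)
  then show ?case
    using eq by (simp add: form_add_left[OF b] form_add_left[OF g] form_scale_left[OF b]
        form_scale_left[OF g] algebra_simps)
qed

text \<open>In a basis of \<open>S\<close> the equation becomes \<open>Bm w = l Gm w\<close> for the
  two Gram matrices. As \<open>Gm\<close> is invertible, an eigenvector of
  \<open>Gm\<^sup>-\<^sup>1 Bm\<close> solves it, and one exists over the complex numbers.\<close>

lemma pencil_eigenvector:
  assumes b: "hermitian_form b" and g: "hermitian_form g"
    and S: "subspace S" "finite_dim S" "0 < dim S" and pd: "pos_def_on g S"
  obtains v mu where "v \<in> S" "v \<noteq> 0" "\<And>x. x \<in> S \<Longrightarrow> b x v = complex_of_real mu * g x v"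
proof -
  obtain B where B: "finite B" "independent B" "B \<subseteq> S" "span B = S" "card B = dim S"
    using subspace_basis[OF S(1,2)] .
  define k where "k = dim S"
  have k: "k > 0" using S(3) k_def by simp
  obtain f where f: "bij_betw f {0..<k} B"
    using ex_bij_betw_nat_finite[OF B(1)] B(5) k_def by metis
  define comb where "comb w = (\<Sum>j<k. (w $ j) *s f j)" for w
  have fB: "f i \<in> B" if "i < k" for i using f that by (auto simp: bij_betw_def)
  have combS: "comb w \<in> S" for w
    unfolding comb_def using fB B(3) S(1) by (intro subspace_sum subspace_scale) auto
  have comb_nz: "comb w \<noteq> 0" if w: "w \<in> carrier_vec k" "w \<noteq> 0\<^sub>v k" for w
  proof
    assume 0: "comb w = 0"
    define u where "u x = w $ (the_inv_into {0..<k} f x)" for x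
    have "(\<Sum>x\<in>B. u x *s x) = (\<Sum>j\<in>{0..<k}. u (f j) *s f j)"
      using sum.reindex_bij_betw[OF f, of "\<lambda>x. u x *s x"] by simp
    also have "\<dots> = comb w" unfolding comb_def atLeast0LessThan
      by (rule sum.cong) (use f in \<open>auto simp: u_def bij_betw_def the_inv_into_f_f\<close>)
    finally have "(\<Sum>x\<in>B. u x *s x) = 0" using 0 by simp
    then have uz: "\<forall>x\<in>B. u x = 0"
      using B(1,2) independentD[of B B u] by blast
    have "w = 0\<^sub>v k"
    proof
      fix i assume "i < dim_vec (0\<^sub>v k :: complex vec)"
      then have i: "i < k" by simp
      then have "u (f i) = w $ i" unfolding u_def using f by (auto simp: bij_betw_def the_inv_into_f_f)
      then show "w $ i = 0\<^sub>v k $ i" using uz fB i by auto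
    qed (use w in simp)
    with w show False by simp
  qed
  define Gm where "Gm = mat k k (\<lambda>(i,j). g (f i) (f j))"
  define Bm where "Bm = mat k k (\<lambda>(i,j). b (f i) (f j))"
  have Gc: "Gm \<in> carrier_mat k k" and Bc: "Bm \<in> carrier_mat k k" by (auto simp: Gm_def Bm_def)
  have Gcomb: "(Gm *\<^sub>v w) $ i = g (f i) (comb w)" and Bcomb: "(Bm *\<^sub>v w) $ i = b (f i) (comb w)"
    if "w \<in> carrier_vec k" "i < k" for w i
    using that by (auto simp: Gm_def Bm_def comb_def form_sum_right[OF g] form_sum_right[OF b]
      form_scale_right[OF g] form_scale_right[OF b] scalar_prod_def mult.commute atLeast0LessThan
      intro!: sum.cong)
  have fspan: "g x (comb w) = 0" if "\<And>i. i < k \<Longrightarrow> g (f i) (comb w) = 0" "x \<in> S" for x w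
  proof -
    have "g x (comb w) = 0 * g x (comb w)"
    proof (rule form_eq_on_span[OF g g, where B = B])
      fix u assume "u \<in> B"
      then obtain i where "i < k" "u = f i" using f by (auto simp: bij_betw_def)
      then show "g u (comb w) = 0 * g u (comb w)" using that by simp
    qed (use that B in auto)
    then show ?thesis by simp
  qed
  \<comment> \<open>A null vector of the Gram matrix gives a nonzero vector of \<open>S\<close> that
    is \<open>g\<close>-orthogonal to all of \<open>S\<close>, in particular to itself.\<close>
  have "det Gm \<noteq> 0"
  proof
    assume "det Gm = 0"
    then obtain w where w: "w \<in> carrier_vec k" "w \<noteq> 0\<^sub>v k" "Gm *\<^sub>v w = 0\<^sub>v k"
      using det_0_iff_vec_prod_zero_field[OF Gc] by blast
    then have "g (f i) (comb w) = 0" if "i < k" for i using Gcomb[OF w(1) that] that by simp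
    then have "g (comb w) (comb w) = 0" using fspan combS by blast
    with pd combS comb_nz[OF w(1,2)] show False unfolding pos_def_on_def by force
  qed
  then obtain Gi where Gi: "Gi \<in> carrier_mat k k" "Gm * Gi = 1\<^sub>m k"
    using obtain_mat_inverse[OF Gc] by metis
  have T: "Gi * Bm \<in> carrier_mat k k" using Gi Bc by simp
  obtain l where "l \<in> spectrum (Gi * Bm)" using spectrum_non_empty[OF T k] by blast
  then obtain w where "eigenvector (Gi * Bm) w l" unfolding spectrum_def eigenvalue_def by auto
  then have w: "w \<in> carrier_vec k" "w \<noteq> 0\<^sub>v k" "(Gi * Bm) *\<^sub>v w = l \<cdot>\<^sub>v w"
    unfolding eigenvector_def using T by auto
  have "Bm *\<^sub>v w = (Gm * Gi) *\<^sub>v (Bm *\<^sub>v w)" using Gi Bc w(1) by simp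
  also have "\<dots> = Gm *\<^sub>v (Gi *\<^sub>v (Bm *\<^sub>v w))"
    by (rule assoc_mult_mat_vec[OF Gc Gi(1)]) (use Bc w(1) in simp)
  also have "Gi *\<^sub>v (Bm *\<^sub>v w) = l \<cdot>\<^sub>v w"
    using w(3) assoc_mult_mat_vec[OF Gi(1) Bc w(1)] by simp
  also have "Gm *\<^sub>v (l \<cdot>\<^sub>v w) = l \<cdot>\<^sub>v (Gm *\<^sub>v w)" by (rule mult_mat_vec[OF Gc w(1)])
  finally have ev: "Bm *\<^sub>v w = l \<cdot>\<^sub>v (Gm *\<^sub>v w)" .
  define v where "v = comb w"
  have vS: "v \<in> S" "v \<noteq> 0" unfolding v_def using combS comb_nz w by auto
  have gen: "b (f i) v = l * g (f i) v" if "i < k" for i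
    unfolding v_def Bcomb[OF w(1) that, symmetric] Gcomb[OF w(1) that, symmetric] ev
    using that Gc w by simp
  have gen': "b u v = l * g u v" if "u \<in> B" for u
    using gen f that by (auto simp: bij_betw_def)
  have all: "b x v = l * g x v" if "x \<in> span B" for x
    by (rule form_eq_on_span[OF b g gen' that])
  have "b v v = l * g v v" using all vS B(4) by simp
  moreover have "0 < Re (g v v)" using pd vS unfolding pos_def_on_def by blast
  \<comment> \<open>The eigenvalue is real, being a quotient of diagonal values of two Hermitian
    forms.\<close>
  ultimately have "l = complex_of_real (Re (b v v) / Re (g v v))"
    using form_diag_real[OF b, of v] form_diag_real[OF g, of v]
    by (metis nonzero_mult_div_cancel_right of_real_divide of_real_eq_0_iff less_irrefl)
  with all vS B(4) show ?thesis using that by blast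
qed

definition orthonormal :: "('v \<Rightarrow> 'v \<Rightarrow> complex) \<Rightarrow> 'v set \<Rightarrow> bool" where
  "orthonormal g B \<longleftrightarrow> (\<forall>u\<in>B. \<forall>v\<in>B. g u v = (if u = v then 1 else 0))"

text \<open>Induction on the dimension: a \<open>g\<close>-normalized eigenvector \<open>u\<close>
  of the pencil is split off. Its eigenvalue equation makes the \<open>g\<close>-orthogonal
  complement of \<open>u\<close> in \<open>S\<close> also \<open>b\<close>-orthogonal to
  \<open>u\<close>, so the basis of the complement can be kept.\<close>

lemma simultaneous_diagonalization:
  assumes b: "hermitian_form b" and g: "hermitian_form g"
    and S: "subspace S" "finite_dim S" and pd: "pos_def_on g S"
  obtains B mu where "finite B" "independent B" "span B = S" "orthonormal g B"
    "\<And>x v. x \<in> S \<Longrightarrow> v \<in> B \<Longrightarrow> b x v = complex_of_real (mu v) * g x v"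
proof -
  have "\<exists>B mu. finite B \<and> independent B \<and> span B = S \<and> orthonormal g B \<and>
     (\<forall>x\<in>S. \<forall>v\<in>B. b x v = complex_of_real (mu v) * g x v)"
    using S pd
  proof (induction "dim S" arbitrary: S rule: less_induct)
    case less
    show ?case
    proof (cases "dim S = 0")
      case True
      have "S \<subseteq> {0}"
        using True subspace_basis[OF less.prems(1,2)]
        by (metis card_0_eq span_empty subset_refl)
      then have "S = {0}" using subspace_0[OF less.prems(1)] by blast
      then show ?thesis using independent_empty by (intro exI[of _ "{}"]) (simp add: orthonormal_def)
    next
      case False
      then have "0 < dim S" by simp
      then obtain v m where v: "v \<in> S" "v \<noteq> 0"
        and ev: "\<And>x. x \<in> S \<Longrightarrow> b x v = complex_of_real m * g x v"
        using pencil_eigenvector[OF b g less.prems(1,2) _ less.prems(3)] by metis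
      have gv: "0 < Re (g v v)" using less.prems(3) v unfolding pos_def_on_def by blast
      define r where "r = complex_of_real (1 / sqrt (Re (g v v)))"
      define u where "u = r *s v"
      have uS: "u \<in> S" unfolding u_def using v less.prems(1) by (simp add: subspace_scale)
      have "g u u = cnj r * r * complex_of_real (Re (g v v))"
        unfolding u_def by (metis form_scale_left[OF g] form_scale_right[OF g] mult.assoc mult.left_commute form_diag_real[OF g])
      also have "\<dots> = complex_of_real ((1 / sqrt (Re (g v v)))\<^sup>2 * Re (g v v))"
        unfolding r_def by (simp only: of_real_mult power2_eq_square complex_cnj_complex_of_real)
      also have "(1 / sqrt (Re (g v v)))\<^sup>2 * Re (g v v) = 1"
        using gv by (simp add: power_divide)
      finally have guu: "g u u = 1" by simp
      have evu: "b x u = complex_of_real m * g x u" if "x \<in> S" for x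
        unfolding u_def using ev[OF that] by (simp add: form_scale_right[OF b] form_scale_right[OF g])
      let ?S1 = "{x\<in>S. g u x = 0}"
      have sub1: "subspace ?S1"
        by (rule subspace_functional_kernel)
          (auto simp: less.prems form_add_right[OF g] form_scale_right[OF g])
      have fd1: "finite_dim ?S1" by (rule finite_dim_subset[OF less.prems(2)]) auto
      have "dim ?S1 + 1 = dim (span (insert u ?S1))"
        using dim_span_insert[OF sub1 fd1, of u] guu by simp
      also have "\<dots> \<le> dim S"
        by (rule dim_mono_finite_dim[OF less.prems(2)])
          (rule span_minimal, use uS less.prems(1) in auto)
      finally have "dim ?S1 < dim S" by simp
      moreover have "pos_def_on g ?S1" using less.prems(3) unfolding pos_def_on_def by blast
      ultimately obtain B1 mu where B1: "finite B1" "independent B1" "span B1 = ?S1"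
        "orthonormal g B1" "\<forall>x\<in>?S1. \<forall>v\<in>B1. b x v = complex_of_real (mu v) * g x v"
        using less.hyps sub1 fd1 by blast
      have uB1: "g u w = 0" "w \<in> S" if "w \<in> B1" for w
        using B1(3) span_base[OF that] by auto
      have uB1': "g w u = 0" if "w \<in> B1" for w
        using uB1(1)[OF that] form_cnj[OF g, of w u] by simp
      have nu: "u \<notin> ?S1" using guu by simp
      then have nuB: "u \<notin> B1" using B1(3) span_base by blast
      have ind: "independent (insert u B1)"
        using independent_insertI[of u B1] B1(2,3) nu by simp
      have decomp: "x - g u x *s u \<in> ?S1" if "x \<in> S" for x
      proof -
        have "g u (x - g u x *s u) = g u (x + (- g u x) *s u)" by simp
        also have "\<dots> = 0" unfolding form_add_right[OF g] form_scale_right[OF g] guu by simp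
        finally show ?thesis using that uS less.prems(1) by (simp add: subspace_diff subspace_scale)
      qed
      have sp: "span (insert u B1) = S"
      proof
        show "span (insert u B1) \<subseteq> S"
          by (rule span_minimal) (use uS uB1(2) less.prems(1) in auto)
        show "S \<subseteq> span (insert u B1)"
          using decomp B1(3) unfolding span_insert by blast
      qed
      have orth: "orthonormal g (insert u B1)"
        using B1(4) guu uB1(1) uB1' nuB unfolding orthonormal_def by auto
      \<comment> \<open>For \<open>w\<close> in \<open>B1\<close> the induction hypothesis covers
        only test vectors orthogonal to \<open>u\<close>. Along \<open>u\<close> itself both
        \<open>b u w\<close> and \<open>g u w\<close> vanish.\<close>
      have "b x w = complex_of_real ((mu(u := m)) w) * g x w" if "x \<in> S" "w \<in> insert u B1" for x w
      proof (cases "w = u")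
        case True
        then show ?thesis using evu that by simp
      next
        case False
        then have w: "w \<in> B1" using that by simp
        have "x = (x - g u x *s u) + g u x *s u" by simp
        moreover have "b (x - g u x *s u) w = complex_of_real (mu w) * g (x - g u x *s u) w"
          using B1(5) decomp[OF that(1)] w by blast
        moreover have "b u w = 0"
          using evu[OF uB1(2)[OF w]] uB1'[OF w] form_cnj[OF b, of u w] by simp
        ultimately have "b x w = complex_of_real (mu w) * g x w"
          using uB1(1)[OF w] form_add_left[OF b] form_add_left[OF g] form_scale_left[OF b] form_scale_left[OF g]
          by (metis mult_zero_right add.right_neutral)
        then show ?thesis using False by simp
      qed
      then show ?thesis using ind sp orth B1(1)
        by (intro exI[of _ "insert u B1"] exI[of _ "mu(u := m)"]) blast
    qed
  qed
  then show ?thesis using that by blast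
qed

lemma orthonormal_expansion:
  assumes g: "hermitian_form g" and B: "finite B" "orthonormal g B" and x: "x \<in> span B"
  shows "x = (\<Sum>v\<in>B. g v x *s v)"
proof -
  obtain u where u: "x = (\<Sum>v\<in>B. u v *s v)" using x span_finite[OF B(1)] by auto
  have "g v x = u v" if "v \<in> B" for v
  proof -
    have "g v x = (\<Sum>w\<in>B. u w * g v w)"
      unfolding u by (simp add: form_sum_right[OF g] form_scale_right[OF g])
    also have "\<dots> = (\<Sum>w\<in>B. if w = v then u v else 0)"
      by (rule sum.cong) (use B(2) that in \<open>auto simp: orthonormal_def\<close>)
    also have "\<dots> = u v" using B(1) that by simp
    finally show ?thesis .
  qed
  then show ?thesis using u by simp
qed

lemma orthonormal_independent:
  assumes g: "hermitian_form g" and B: "finite B" "orthonormal g B"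
  shows "independent B"
proof (rule independent_if_scalars_zero[OF B(1)])
  fix u v assume z: "(\<Sum>v\<in>B. u v *s v) = 0" and v: "v \<in> B"
  have "u v = (\<Sum>w\<in>B. if w = v then u v else 0)" using B(1) v by simp
  also have "\<dots> = (\<Sum>w\<in>B. u w * g v w)"
    by (rule sum.cong) (use B(2) v in \<open>auto simp: orthonormal_def\<close>)
  also have "\<dots> = g v (\<Sum>v\<in>B. u v *s v)"
    by (simp add: form_sum_right[OF g] form_scale_right[OF g])
  finally show "u v = 0" using z by (simp add: form_zero_right[OF g])
qed

lemma diagonalized_form_eq:
  assumes b: "hermitian_form b" and g: "hermitian_form g"
    and B: "finite B" "orthonormal g B"
    and ev: "\<And>x v. x \<in> span B \<Longrightarrow> v \<in> B \<Longrightarrow> b x v = complex_of_real (mu v) * g x v"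
    and x: "x \<in> span B"
  shows "Re (b x x) = (\<Sum>v\<in>B. mu v * (cmod (g v x))\<^sup>2)"
proof -
  have "b x x = b x (\<Sum>v\<in>B. g v x *s v)" using orthonormal_expansion[OF g B x] by simp
  also have "\<dots> = (\<Sum>v\<in>B. g v x * b x v)"
    by (simp add: form_sum_right[OF b] form_scale_right[OF b])
  also have "\<dots> = (\<Sum>v\<in>B. complex_of_real (mu v * (cmod (g v x))\<^sup>2))"
  proof (rule sum.cong)
    fix v assume "v \<in> B"
    then have "g v x * b x v = complex_of_real (mu v) * (g v x * cnj (g v x))"
      using ev[OF x] form_cnj[OF g, of x v] by simp
    then show "g v x * b x v = complex_of_real (mu v * (cmod (g v x))\<^sup>2)"
      using complex_norm_square[of "g v x"] by simp
  qed simp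
  finally show ?thesis by simp
qed

text \<open>Sylvester's argument: a larger \<open>S\<close> would contain a nonzero \<open>x\<close>
  that is \<open>g\<close>-orthogonal to every basis vector with \<open>mu v \<ge> 0\<close>. Then
  \<open>b x x\<close> is a sum of squares with only negative weights, at least one square being
  nonzero.\<close>

lemma nonneg_subspace_dim_le:
  assumes b: "hermitian_form b" and g: "hermitian_form g"
    and B: "finite B" "orthonormal g B"
    and ev: "\<And>x v. x \<in> span B \<Longrightarrow> v \<in> B \<Longrightarrow> b x v = complex_of_real (mu v) * g x v"
    and S: "subspace S" "S \<subseteq> span B" "nonneg_on b S"
  shows "dim S \<le> card {v\<in>B. 0 \<le> mu v}"
proof (rule ccontr)
  assume less: "\<not> ?thesis"
  let ?I = "{v\<in>B. 0 \<le> mu v}"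
  let ?T = "{x\<in>S. \<forall>v\<in>?I. g v x = 0}"
  have fdS: "finite_dim S" using S(2) B(1) finite_dim_span finite_dim_subset by blast
  have "subspace ?T \<and> dim S \<le> dim ?T + card ?I"
    by (rule dim_functionals_kernel)
      (use B(1) S(1) fdS in \<open>simp_all add: form_add_right[OF g] form_scale_right[OF g]\<close>)
  then have "0 < dim ?T" using less by linarith
  then obtain x where x: "x \<in> ?T" "x \<noteq> 0" using dim_pos_nonzero by blast
  then have xS: "x \<in> S" "x \<in> span B" using S(2) by auto
  have "\<exists>w\<in>B. g w x \<noteq> 0"
  proof (rule ccontr)
    assume "\<not> ?thesis"
    then have "(\<Sum>v\<in>B. g v x *s v) = 0" by (intro sum.neutral) auto
    with x(2) orthonormal_expansion[OF g B xS(2)] show False by simp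
  qed
  then obtain w where w: "w \<in> B" "g w x \<noteq> 0" by blast
  have "Re (b x x) = (\<Sum>v\<in>B. mu v * (cmod (g v x))\<^sup>2)"
    by (rule diagonalized_form_eq[OF b g B ev xS(2)])
  also have "\<dots> < (\<Sum>v\<in>B. 0)"
  proof (rule sum_strict_mono_ex1[OF B(1)])
    have "mu v * (cmod (g v x))\<^sup>2 \<le> 0" if "v \<in> B" for v
      using x(1) that by (cases "0 \<le> mu v") (auto simp: mult_nonpos_nonneg)
    then show "\<forall>v\<in>B. mu v * (cmod (g v x))\<^sup>2 \<le> 0" by blast
    have "\<not> 0 \<le> mu w" using x(1) w by auto
    then have "mu w * (cmod (g w x))\<^sup>2 < 0" using w by (simp add: mult_neg_pos)
    then show "\<exists>a\<in>B. mu a * (cmod (g a x))\<^sup>2 < 0" using w by blast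
  qed
  finally have "Re (b x x) < 0" by simp
  with S(3) xS show False unfolding nonneg_on_def by fastforce
qed

text \<open>Only nonnegative weights occur in the diagonal expansion on this span, so the bound of
  \<open>nonneg_subspace_dim_le\<close> is attained.\<close>

lemma nonneg_on_span_nonneg:
  assumes b: "hermitian_form b" and g: "hermitian_form g"
    and B: "finite B" "orthonormal g B"
    and ev: "\<And>x v. x \<in> span B \<Longrightarrow> v \<in> B \<Longrightarrow> b x v = complex_of_real (mu v) * g x v"
  shows "nonneg_on b (span {v\<in>B. 0 \<le> mu v})"
proof -
  let ?I = "{v\<in>B. 0 \<le> mu v}"
  have sub: "span ?I \<subseteq> span B" by (rule span_mono) auto
  have "Re (b x x) \<ge> 0" if "x \<in> span ?I" for x
  proof -
    have "Re (b x x) = (\<Sum>v\<in>?I. mu v * (cmod (g v x))\<^sup>2)"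
      by (rule diagonalized_form_eq[OF b g _ _ _ that])
        (use B sub ev in \<open>auto simp: orthonormal_def\<close>)
    also have "\<dots> \<ge> 0" by (rule sum_nonneg) auto
    finally show ?thesis .
  qed
  then show ?thesis unfolding nonneg_on_def by blast
qed

end

section \<open>Eigenvalue counts and zero-dilation index in terms of subspaces\<close>

definition fscale :: "complex \<Rightarrow> (nat \<Rightarrow> complex) \<Rightarrow> nat \<Rightarrow> complex" where
  "fscale c x = (\<lambda>i. c * x i)"

lemma fscale_apply [simp]: "fscale c x i = c * x i"
  by (simp add: fscale_def)

interpretation fv: complex_vector_space fscale
  by unfold_locales (auto simp: fun_eq_iff algebra_simps)

text \<open>The coordinate space of dimension \<open>N\<close>. All sizes live in a single vector
  space, so passing to a leading block is the literal inclusion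
  \<open>vecs N' \<subseteq> vecs N\<close>.\<close>

definition vecs :: "nat \<Rightarrow> (nat \<Rightarrow> complex) set" where
  "vecs N = {x. \<forall>i\<ge>N. x i = 0}"

definition unit_fun :: "nat \<Rightarrow> nat \<Rightarrow> complex" where
  "unit_fun i = (\<lambda>j. if j = i then 1 else 0)"

definition ip :: "nat \<Rightarrow> (nat \<Rightarrow> complex) \<Rightarrow> (nat \<Rightarrow> complex) \<Rightarrow> complex" where
  "ip N x y = (\<Sum>i<N. cnj (x i) * y i)"

text \<open>The value \<open>0\<close> beyond the last row puts the result in
  \<open>vecs (dim_row A)\<close> for every argument \<open>x\<close>.\<close>

definition app :: "complex mat \<Rightarrow> (nat \<Rightarrow> complex) \<Rightarrow> nat \<Rightarrow> complex" where
  "app A x = (\<lambda>i. if i < dim_row A then \<Sum>j<dim_col A. A $$ (i, j) * x j else 0)"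

lemma mat_adjoint_dim [simp]:
  "dim_row (mat_adjoint (A :: complex mat)) = dim_col A" "dim_col (mat_adjoint A) = dim_row A"
  by (simp_all add: mat_adjoint_def)

lemma mat_adjoint_index [simp]:
  "i < dim_col A \<Longrightarrow> j < dim_row A \<Longrightarrow> mat_adjoint (A :: complex mat) $$ (i, j) = cnj (A $$ (j, i))"
  by (simp add: mat_adjoint_def mat_of_rows_index)

lemma mat_adjoint_carrier [simp]:
  "A \<in> carrier_mat n m \<Longrightarrow> mat_adjoint (A :: complex mat) \<in> carrier_mat m n"
  by auto

lemma sum_apply: "(\<Sum>x\<in>A. f x :: 'b \<Rightarrow> 'c :: comm_monoid_add) i = (\<Sum>x\<in>A. f x i)"
  by (induction A rule: infinite_finite_induct) auto

lemma subspace_vecs: "fv.subspace (vecs N)"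
  by (rule fv.subspaceI) (auto simp: vecs_def)

lemma unit_fun_vecs [simp]: "i < N \<Longrightarrow> unit_fun i \<in> vecs N"
  by (auto simp: vecs_def unit_fun_def)

lemma vecs_expansion: "x \<in> vecs N \<Longrightarrow> x = (\<Sum>i<N. fscale (x i) (unit_fun i))"
  by (rule ext) (simp add: sum_apply unit_fun_def vecs_def if_distrib cong: if_cong)

lemma span_unit_fun: "fv.span (unit_fun ` {..<N}) = vecs N"
proof
  show "fv.span (unit_fun ` {..<N}) \<subseteq> vecs N"
    by (rule fv.span_minimal) (auto simp: subspace_vecs)
  show "vecs N \<subseteq> fv.span (unit_fun ` {..<N})"
  proof
    fix x assume "x \<in> vecs N"
    then have "x = (\<Sum>i<N. fscale (x i) (unit_fun i))" by (rule vecs_expansion)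
    also have "\<dots> \<in> fv.span (unit_fun ` {..<N})"
      by (intro fv.span_sum fv.span_scale fv.span_base) auto
    finally show "x \<in> fv.span (unit_fun ` {..<N})" .
  qed
qed

lemma finite_dim_vecs: "fv.finite_dim (vecs N)"
  unfolding span_unit_fun[symmetric] by (rule fv.finite_dim_span) simp

lemma hermitian_form_ip: "fv.hermitian_form (ip N)"
  unfolding fv.hermitian_form_def ip_def
  by (simp add: algebra_simps sum.distrib sum_distrib_left)

lemmas ip_add_right = fv.form_add_right[OF hermitian_form_ip]
  and ip_add_left = fv.form_add_left[OF hermitian_form_ip]
  and ip_scale_right = fv.form_scale_right[OF hermitian_form_ip]
  and ip_scale_left = fv.form_scale_left[OF hermitian_form_ip]
  and ip_cnj = fv.form_cnj[OF hermitian_form_ip]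
  and ip_zero_right [simp] = fv.form_zero_right[OF hermitian_form_ip]
  and ip_zero_left [simp] = fv.form_zero_left[OF hermitian_form_ip]

lemma ip_self: "ip N x x = complex_of_real (\<Sum>i<N. (cmod (x i))\<^sup>2)"
  unfolding ip_def by (simp add: complex_norm_square mult.commute del: of_real_power)

lemma ip_self_eq_0: "x \<in> vecs N \<Longrightarrow> ip N x x = 0 \<longleftrightarrow> x = 0"
  unfolding ip_self of_real_eq_0_iff
  by (subst sum_nonneg_eq_0_iff) (auto simp: vecs_def fun_eq_iff not_less[symmetric])

lemma pos_def_ip: "fv.pos_def_on (ip N) (vecs N)"
  unfolding fv.pos_def_on_def
proof (intro ballI impI)
  fix x assume x: "x \<in> vecs N" "x \<noteq> 0"
  have "0 \<le> Re (ip N x x)" unfolding ip_self by (simp add: sum_nonneg)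
  moreover have "Re (ip N x x) \<noteq> 0"
    using ip_self_eq_0[OF x(1)] x(2) unfolding ip_self of_real_eq_0_iff Re_complex_of_real by blast
  ultimately show "0 < Re (ip N x x)" by simp
qed

lemma vecs_eqI:
  assumes "x \<in> vecs N" "y \<in> vecs N" "\<And>z. z \<in> vecs N \<Longrightarrow> ip N z x = ip N z y"
  shows "x = y"
proof -
  have d: "x - y \<in> vecs N" using assms by (auto simp: vecs_def)
  have "ip N (x - y) (x - y) = ip N (x - y) x - ip N (x - y) y"
    by (simp add: ip_def algebra_simps sum_subtractf)
  then have "x - y = 0" using assms(3)[OF d] ip_self_eq_0[OF d] by simp
  then show ?thesis by simp
qed

lemma ip_unit_fun_left [simp]: "i < N \<Longrightarrow> ip N (unit_fun i) y = y i"
  by (simp add: ip_def unit_fun_def if_distrib if_distribR cong: if_cong)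

lemma unit_fun_inj: "inj unit_fun"
  by (rule injI) (metis unit_fun_def zero_neq_one)

lemma orthonormal_unit_fun: "fv.orthonormal (ip N) (unit_fun ` {..<N})"
  unfolding fv.orthonormal_def
proof (intro ballI)
  fix u v assume "u \<in> unit_fun ` {..<N}" "v \<in> unit_fun ` {..<N}"
  then obtain i j where "i < N" "u = unit_fun i" "v = unit_fun j" by auto
  then show "ip N u v = (if u = v then 1 else 0)"
    by (simp add: inj_eq[OF unit_fun_inj]) (simp add: unit_fun_def)
qed

lemma dim_vecs: "fv.dim (vecs N) = N"
proof -
  have "fv.independent (unit_fun ` {..<N})"
    by (rule fv.orthonormal_independent[OF hermitian_form_ip _ orthonormal_unit_fun]) simp
  then have "fv.dim (fv.span (unit_fun ` {..<N})) = card (unit_fun ` {..<N})"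
    by (simp add: fv.dim_eq_card_independent)
  also have "\<dots> = N" by (simp add: card_image inj_on_subset[OF unit_fun_inj])
  finally show ?thesis by (simp add: span_unit_fun)
qed

lemma app_vecs [simp]: "dim_row A = N \<Longrightarrow> app A x \<in> vecs N"
  by (simp add: app_def vecs_def)

lemma app_add: "app A (x + y) = app A x + app A y"
  by (rule ext) (simp add: app_def algebra_simps sum.distrib)

lemma app_scale: "app A (fscale c x) = fscale c (app A x)"
  by (rule ext) (simp add: app_def sum_distrib_left mult.left_commute)

lemma linear_app: "Vector_Spaces.linear fscale fscale (app A)"
  unfolding Vector_Spaces.linear_def module_hom_def module_hom_axioms_def
  using fv.vector_space_axioms fv.module_axioms by (simp add: app_add app_scale)

lemma app_zero [simp]: "app A 0 = 0"
  by (rule ext) (simp add: app_def)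

lemma app_mult: "A \<in> carrier_mat n m \<Longrightarrow> B \<in> carrier_mat m l \<Longrightarrow> app (A * B) x = app A (app B x)"
  by (rule ext) (auto simp: app_def scalar_prod_def sum_distrib_left sum_distrib_right mult.assoc
      atLeast0LessThan intro: sum.swap)

lemma app_plus: "A \<in> carrier_mat n m \<Longrightarrow> B \<in> carrier_mat n m \<Longrightarrow> app (A + B) x = app A x + app B x"
  by (rule ext) (auto simp: app_def algebra_simps sum.distrib)

lemma app_minus: "A \<in> carrier_mat n m \<Longrightarrow> B \<in> carrier_mat n m \<Longrightarrow> app (A - B) x = app A x - app B x"
  by (rule ext) (auto simp: app_def algebra_simps sum_subtractf)

lemma app_smult: "app (c \<cdot>\<^sub>m A) x = fscale c (app A x)"
  by (rule ext) (simp add: app_def sum_distrib_left mult.assoc)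

lemma app_one: "x \<in> vecs N \<Longrightarrow> app (1\<^sub>m N) x = x"
  by (rule ext) (simp add: app_def vecs_def if_distrib if_distribR cong: if_cong)

lemma app_unit_fun: "j < dim_col A \<Longrightarrow> i < dim_row A \<Longrightarrow> app A (unit_fun j) i = A $$ (i, j)"
  by (simp add: app_def unit_fun_def if_distrib if_distribR cong: if_cong)

lemma app_eqI:
  assumes "A \<in> carrier_mat n m" "B \<in> carrier_mat n m" "\<And>j. j < m \<Longrightarrow> app A (unit_fun j) = app B (unit_fun j)"
  shows "A = B"
proof (rule eq_matI)
  fix i j assume "i < dim_row B" "j < dim_col B"
  then show "A $$ (i, j) = B $$ (i, j)"
    using assms app_unit_fun[of j A i] app_unit_fun[of j B i] by auto
qed (use assms in auto)

lemma ip_app_adjoint: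
  assumes "A \<in> carrier_mat n m"
  shows "ip n x (app A y) = ip m (app (mat_adjoint A) x) y"
proof -
  have "ip n x (app A y) = (\<Sum>i<n. \<Sum>j<m. cnj (x i) * (A $$ (i, j) * y j))"
    using assms by (simp add: ip_def app_def sum_distrib_left)
  also have "\<dots> = (\<Sum>j<m. \<Sum>i<n. cnj (x i) * (A $$ (i, j) * y j))" by (rule sum.swap)
  also have "\<dots> = ip m (app (mat_adjoint A) x) y"
    unfolding ip_def
  proof (rule sum.cong)
    fix j assume "j \<in> {..<m}"
    then show "(\<Sum>i<n. cnj (x i) * (A $$ (i, j) * y j)) = cnj (app (mat_adjoint A) x j) * y j"
      using assms by (simp add: app_def sum_distrib_left mult_ac)
  qed simp
  finally show ?thesis .
qed

lemma mat_adjoint_adjoint [simp]: "mat_adjoint (mat_adjoint A) = (A :: complex mat)"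
  by (rule eq_matI) auto

lemma hermitian_form_mat:
  assumes H: "H \<in> carrier_mat N N" "mat_adjoint H = H"
  shows "fv.hermitian_form (\<lambda>x y. ip N x (app H y))"
  unfolding fv.hermitian_form_def
proof (intro conjI allI)
  fix x y show "ip N y (app H x) = cnj (ip N x (app H y))"
    using ip_app_adjoint[OF H(1), of y x] H(2) ip_cnj[of N "app H y" x] by simp
qed (simp_all add: app_add app_scale ip_add_right ip_scale_right)

definition mat_of_funs :: "nat \<Rightarrow> (nat \<Rightarrow> nat \<Rightarrow> complex) \<Rightarrow> complex mat" where
  "mat_of_funs N f = mat N N (\<lambda>(i, j). f j i)"

lemma mat_of_funs_carrier [simp]: "mat_of_funs N f \<in> carrier_mat N N"
  by (simp add: mat_of_funs_def)

lemma app_mat_of_funs: "f j \<in> vecs N \<Longrightarrow> j < N \<Longrightarrow> app (mat_of_funs N f) (unit_fun j) = f j"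
  by (rule ext) (auto simp: mat_of_funs_def app_def unit_fun_def if_distrib if_distribR vecs_def cong: if_cong)

lemma mat_index_ip: "A \<in> carrier_mat N M \<Longrightarrow> i < N \<Longrightarrow> j < M \<Longrightarrow> A $$ (i, j) = ip N (unit_fun i) (app A (unit_fun j))"
  by (simp add: app_unit_fun)

text \<open>Moving \<open>U\<close> across the inner product turns entries of a unitarily similar
  matrix into values of the form of \<open>X\<close> at columns of \<open>U\<close>. This links zero
  blocks with isotropic subspaces.\<close>

lemma adjoint_mult_index:
  assumes "U \<in> carrier_mat N N" "X \<in> carrier_mat N N" "i < N" "j < N"
  shows "(mat_adjoint U * X * U) $$ (i, j) = ip N (app U (unit_fun i)) (app X (app U (unit_fun j)))"
proof -
  have adj: "mat_adjoint U \<in> carrier_mat N N" using assms by simp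
  then have "mat_adjoint U * X \<in> carrier_mat N N" using assms(2) by (rule mult_carrier_mat)
  then have "app (mat_adjoint U * X * U) (unit_fun j) = app (mat_adjoint U) (app X (app U (unit_fun j)))"
    using app_mult[OF _ assms(1)] app_mult[OF adj assms(2)] by metis
  then have "(mat_adjoint U * X * U) $$ (i, j) = ip N (unit_fun i) (app (mat_adjoint U) (app X (app U (unit_fun j))))"
    using assms by (subst mat_index_ip[of _ N N]) auto
  also have "\<dots> = ip N (app U (unit_fun i)) (app X (app U (unit_fun j)))"
    using assms by (subst ip_app_adjoint[of _ N N]) auto
  finally show ?thesis .
qed

lemma unitary_of_orthonormal:
  assumes "\<And>i. i < N \<Longrightarrow> f i \<in> vecs N"
    and "\<And>i j. i < N \<Longrightarrow> j < N \<Longrightarrow> ip N (f i) (f j) = (if i = j then 1 else 0)"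
  shows "mat_adjoint (mat_of_funs N f) * mat_of_funs N f = 1\<^sub>m N"
proof (rule eq_matI)
  let ?U = "mat_of_funs N f"
  fix i j assume ij: "i < dim_row (1\<^sub>m N)" "j < dim_col (1\<^sub>m N)"
  \<comment> \<open>An identity factor is inserted so that \<open>adjoint_mult_index\<close> applies
    with \<open>X = 1\<close>.\<close>
  have "mat_adjoint ?U * ?U = mat_adjoint ?U * 1\<^sub>m N * ?U"
    by (subst right_mult_one_mat[of _ N N]) auto
  then have "(mat_adjoint ?U * ?U) $$ (i, j) = ip N (f i) (app (1\<^sub>m N) (f j))"
    using ij assms by (simp add: adjoint_mult_index[of _ N] app_mat_of_funs)
  then show "(mat_adjoint ?U * ?U) $$ (i, j) = 1\<^sub>m N $$ (i, j)"
    using ij assms by (simp add: app_one)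
qed (simp_all add: mat_of_funs_def)

section \<open>Extremal dimensions of nonnegative and isotropic subspaces\<close>

lemma order_linear_factors:
  "order c (\<Prod>a\<leftarrow>as. [:- a, 1:]) = length (filter (\<lambda>a. a = c) as)" for c :: "'a::idom"
proof (induction as)
  case (Cons a as)
  have "(\<Prod>a\<leftarrow>as. [:- a, 1:]) \<noteq> 0"
    by (auto simp: prod_list_zero_iff)
  then have "[:- a, 1:] * (\<Prod>a\<leftarrow>as. [:- a, 1:]) \<noteq> 0"
    by (intro no_zero_divisors) auto
  then have "order c ([:- a, 1:] * (\<Prod>a\<leftarrow>as. [:- a, 1:])) = order c [:- a, 1:] + order c (\<Prod>a\<leftarrow>as. [:- a, 1:])"
    by (rule order_mult)
  moreover have "order c [:- a, 1:] = (if a = c then 1 else 0)"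
    using order_linear_power'[of a c] order_0I[of "[:- a, 1:]" c] order_power_n_n[of c 1] by auto
  ultimately show ?case using Cons.IH by simp
qed simp

text \<open>A predicate on \<open>k\<close> rather than a maximum: congruence then transports each
  \<open>k\<close> separately, and maximality enters only when eigenvalues are counted.\<close>

definition nonneg_dim :: "nat \<Rightarrow> complex mat \<Rightarrow> nat \<Rightarrow> bool" where
  "nonneg_dim N H k \<longleftrightarrow> (\<exists>S. fv.subspace S \<and> S \<subseteq> vecs N \<and>
     fv.nonneg_on (\<lambda>x y. ip N x (app H y)) S \<and> fv.dim S = k)"

definition isotropic_dim :: "nat \<Rightarrow> complex mat \<Rightarrow> nat \<Rightarrow> bool" where
  "isotropic_dim N X k \<longleftrightarrow> (\<exists>S. fv.subspace S \<and> S \<subseteq> vecs N \<and>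
     (\<forall>x\<in>S. \<forall>y\<in>S. ip N x (app X y) = 0) \<and> fv.dim S = k)"

text \<open>The characteristic polynomial splits into the factors of the diagonal, so the order of a
  root \<open>x\<close> is the number of indices with \<open>m i = x\<close>. Summing over the
  distinct nonnegative values counts the indices fibre by fibre.\<close>

lemma num_nonneg_eigenvalues_diag:
  assumes H: "H \<in> carrier_mat N N" and sim: "similar_mat H (mat N N (\<lambda>(i, j). if i = j then complex_of_real (m i) else 0))"
  shows "num_nonneg_eigenvalues H = card {i. i < N \<and> 0 \<le> m i}"
proof -
  let ?D = "mat N N (\<lambda>(i, j). if i = j then complex_of_real (m i) else 0)"
  let ?as = "map (\<lambda>i. complex_of_real (m i)) [0..<N]"
  have D: "?D \<in> carrier_mat N N" by simp
  have dg: "diag_mat ?D = ?as" by (simp add: diag_mat_def)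
  have cp: "char_poly H = (\<Prod>a\<leftarrow>?as. [:- a, 1:])"
    unfolding char_poly_similar[OF sim] dg[symmetric]
    by (subst char_poly_upper_triangular[OF D]) auto
  have ord: "order (complex_of_real x) (char_poly H) = card {i. i < N \<and> m i = x}" for x
  proof -
    have "order (complex_of_real x) (char_poly H) = length (filter (\<lambda>i. m i = x) [0..<N])"
      unfolding cp order_linear_factors by (simp add: filter_map o_def)
    also have "\<dots> = card (set (filter (\<lambda>i. m i = x) [0..<N]))"
      by (rule distinct_card[symmetric]) simp
    finally show ?thesis by (simp add: conj_commute)
  qed
  have ev: "eigenvalue H (complex_of_real x) \<longleftrightarrow> x \<in> m ` {..<N}" for x
  proof -
    have "eigenvalue H (complex_of_real x) \<longleftrightarrow> poly (char_poly H) (complex_of_real x) = 0"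
      by (rule eigenvalue_root_char_poly[OF H])
    also have "\<dots> \<longleftrightarrow> x \<in> m ` {..<N}"
      unfolding cp by (auto simp: poly_prod_list prod_list_zero_iff)
    finally show ?thesis .
  qed
  let ?I = "{i. i < N \<and> 0 \<le> m i}"
  have "num_nonneg_eigenvalues H = (\<Sum>x\<in>m ` ?I. card {i. i < N \<and> m i = x})"
    unfolding num_nonneg_eigenvalues_def ord by (rule sum.cong) (auto simp: ev)
  also have "\<dots> = (\<Sum>x\<in>m ` ?I. \<Sum>i\<in>{i\<in>?I. m i = x}. 1)"
    by (rule sum.cong) (auto intro!: arg_cong[where f = card])
  also have "\<dots> = (\<Sum>i\<in>?I. 1)" by (rule sum.image_gen[symmetric]) simp
  finally show ?thesis by simp
qed

text \<open>Diagonalizing the form of \<open>H\<close> relative to \<open>ip N\<close> is the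
  spectral theorem: the matrix \<open>U\<close> of the orthonormal basis makes \<open>H\<close>
  similar to a real diagonal matrix. The eigenvalue count is then the number of basis vectors with
  \<open>mu v \<ge> 0\<close>, which is the largest dimension by Sylvester's argument.\<close>

lemma num_nonneg_eigenvalues_nonneg_dim:
  assumes H: "H \<in> carrier_mat N N" "mat_adjoint H = H"
  shows "nonneg_dim N H (num_nonneg_eigenvalues H)"
    and "nonneg_dim N H k \<Longrightarrow> k \<le> num_nonneg_eigenvalues H"
proof -
  let ?b = "\<lambda>x y. ip N x (app H y)"
  have b: "fv.hermitian_form ?b" by (rule hermitian_form_mat[OF H])
  obtain B mu where B: "finite B" "fv.independent B" "fv.span B = vecs N" "fv.orthonormal (ip N) B"
    and ev: "\<And>x v. x \<in> vecs N \<Longrightarrow> v \<in> B \<Longrightarrow> ?b x v = complex_of_real (mu v) * ip N x v"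
    using fv.simultaneous_diagonalization[OF b hermitian_form_ip subspace_vecs finite_dim_vecs pos_def_ip] by metis
  have ev': "\<And>x v. x \<in> fv.span B \<Longrightarrow> v \<in> B \<Longrightarrow> ?b x v = complex_of_real (mu v) * ip N x v"
    using ev B(3) by simp
  have "card B = N" using fv.dim_span_eq_card_independent[OF B(2)] B(3) dim_vecs by simp
  then obtain f where f: "bij_betw f {0..<N} B" using ex_bij_betw_nat_finite[OF B(1)] by metis
  have fB: "f i \<in> B" "f i \<in> vecs N" if "i < N" for i
    using f that B(3) fv.span_base by (auto simp: bij_betw_def)
  have orth: "ip N (f i) (f j) = (if i = j then 1 else 0)" if "i < N" "j < N" for i j
    using B(4) fB that f unfolding fv.orthonormal_def by (auto simp: bij_betw_def inj_on_eq_iff)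
  define U where "U = mat_of_funs N f"
  let ?D = "mat N N (\<lambda>(i, j). if i = j then complex_of_real (mu (f i)) else 0)"
  have U: "U \<in> carrier_mat N N" unfolding U_def by simp
  have UU: "mat_adjoint U * U = 1\<^sub>m N" unfolding U_def by (rule unitary_of_orthonormal) (use fB orth in auto)
  have UU': "U * mat_adjoint U = 1\<^sub>m N"
    by (rule mat_mult_left_right_inverse[OF _ U UU]) (use U in simp)
  have Dapp: "app ?D (unit_fun j) = fscale (complex_of_real (mu (f j))) (unit_fun j)" if "j < N" for j
  proof (rule ext)
    fix i
    show "app ?D (unit_fun j) i = fscale (complex_of_real (mu (f j))) (unit_fun j) i"
    proof (cases "i < N")
      case True
      then show ?thesis using that app_unit_fun[of j ?D i] by (simp add: unit_fun_def)
    next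
      case False
      then show ?thesis using that by (simp add: app_def unit_fun_def)
    qed
  qed
  have Uapp: "app U (unit_fun j) = f j" if "j < N" for j
    unfolding U_def using fB that by (simp add: app_mat_of_funs)
  have Hf: "app H (f j) = fscale (complex_of_real (mu (f j))) (f j)" if "j < N" for j
  proof (rule vecs_eqI)
    show "app H (f j) \<in> vecs N" using H by simp
    show "fscale (complex_of_real (mu (f j))) (f j) \<in> vecs N"
      using fB(2)[OF that] subspace_vecs fv.subspace_scale by blast
  qed (use ev fB that in \<open>simp add: ip_scale_right\<close>)
  have HU: "H * U = U * ?D"
  proof (rule app_eqI)
    fix j assume j: "j < N"
    show "app (H * U) (unit_fun j) = app (U * ?D) (unit_fun j)"
      using j H U by (simp add: app_mult[of _ N N _ N] Dapp app_scale Uapp Hf)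
  qed (use H U in auto)
  have "H = H * (U * mat_adjoint U)" using UU' H by simp
  also have "\<dots> = U * ?D * mat_adjoint U"
    using H U HU by (simp add: assoc_mult_mat[of _ N N _ N _ N, symmetric])
  finally have "similar_mat_wit H ?D U (mat_adjoint U)"
    unfolding similar_mat_wit_def using U H UU UU' by (auto simp: Let_def)
  then have "similar_mat H ?D" unfolding similar_mat_def by blast
  then have "num_nonneg_eigenvalues H = card {i. i < N \<and> 0 \<le> mu (f i)}"
    by (rule num_nonneg_eigenvalues_diag[OF H(1)])
  also have "\<dots> = card (f ` {i. i < N \<and> 0 \<le> mu (f i)})"
    by (rule card_image[symmetric], rule inj_on_subset[OF bij_betw_imp_inj_on[OF f]]) auto
  also have "f ` {i. i < N \<and> 0 \<le> mu (f i)} = {v\<in>B. 0 \<le> mu v}"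
    using f by (auto simp: bij_betw_def)
  finally have num: "num_nonneg_eigenvalues H = card {v\<in>B. 0 \<le> mu v}" .
  show "nonneg_dim N H (num_nonneg_eigenvalues H)"
    unfolding nonneg_dim_def num
  proof (intro exI conjI)
    let ?I = "{v\<in>B. 0 \<le> mu v}"
    show "fv.subspace (fv.span ?I)" by (rule fv.subspace_span)
    show "fv.span ?I \<subseteq> vecs N" unfolding B(3)[symmetric] by (rule fv.span_mono) auto
    show "fv.nonneg_on ?b (fv.span ?I)"
      by (rule fv.nonneg_on_span_nonneg[OF b hermitian_form_ip B(1,4) ev'])
    have "fv.independent ?I" using B(2) by (rule fv.independent_mono) auto
    then show "fv.dim (fv.span ?I) = card ?I" by (rule fv.dim_span_eq_card_independent)
  qed
  show "k \<le> num_nonneg_eigenvalues H" if k: "nonneg_dim N H k"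
  proof -
    obtain S where S: "fv.subspace S" "S \<subseteq> vecs N" "fv.nonneg_on ?b S" "fv.dim S = k"
      using k unfolding nonneg_dim_def by blast
    have "fv.dim S \<le> card {v\<in>B. 0 \<le> mu v}"
      by (rule fv.nonneg_subspace_dim_le[OF b hermitian_form_ip B(1,4) ev' S(1) _ S(3)])
        (use S(2) B(3) in auto)
    then show ?thesis using S(4) num by simp
  qed
qed

lemma isotropic_span:
  assumes "\<And>x y. x \<in> C \<Longrightarrow> y \<in> C \<Longrightarrow> ip N x (app X y) = 0"
    and "x \<in> fv.span C" "y \<in> fv.span C"
  shows "ip N x (app X y) = 0"
proof -
  have 1: "ip N x (app X y) = 0" if "x \<in> C" "y \<in> fv.span C" for x y
    using that(2)
    by (induction rule: fv.span_induct_alt)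
      (simp_all only: app_zero app_add app_scale ip_zero_right ip_add_right ip_scale_right
        assms(1) that(1) mult_zero_right add_0)
  show ?thesis
    using assms(2)
    by (induction rule: fv.span_induct_alt)
      (simp_all only: ip_zero_left ip_add_left ip_scale_left 1 assms(3) mult_zero_right add_0)
qed

text \<open>The first \<open>k\<close> columns of the unitary matrix are orthonormal, and the zero
  block says that the form of \<open>X\<close> vanishes on every pair of them.\<close>

lemma zero_block_imp_isotropic_dim:
  assumes X: "X \<in> carrier_mat N N" and sim: "unitarily_similar X Y" and zb: "has_leading_zero_block k Y"
  shows "isotropic_dim N X k"
proof -
  obtain U where "unitary_mat U" "dim_row U = dim_row X" and Y: "Y = mat_adjoint U * X * U"
    using sim unfolding unitarily_similar_def by blast
  then have U: "U \<in> carrier_mat N N" "mat_adjoint U * U = 1\<^sub>m N"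
    using X unfolding unitary_mat_def by auto
  obtain r B C D where BCD: "B \<in> carrier_mat k r" "C \<in> carrier_mat r k" "D \<in> carrier_mat r r"
    "Y = four_block_mat (0\<^sub>m k k) B C D"
    using zb unfolding has_leading_zero_block_def by blast
  have kN: "k \<le> N" using arg_cong[OF BCD(4), of dim_row] Y U BCD(3) by simp
  define c where "c j = app U (unit_fun j)" for j
  have cc: "ip N (c i) (c j) = (if i = j then 1 else 0)" if "i < N" "j < N" for i j
  proof -
    have "ip N (c i) (app (1\<^sub>m N) (c j)) = (mat_adjoint U * 1\<^sub>m N * U) $$ (i, j)"
      unfolding c_def using adjoint_mult_index[OF U(1) _ that, of "1\<^sub>m N"] by simp
    also have "\<dots> = (mat_adjoint U * U) $$ (i, j)"
      using U(1) by (subst right_mult_one_mat[of _ N N]) auto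
    finally show ?thesis using that U(1) unfolding U(2) by (simp add: app_one c_def)
  qed
  have cX: "ip N (c i) (app X (c j)) = 0" if "i < k" "j < k" for i j
  proof -
    have "ip N (c i) (app X (c j)) = Y $$ (i, j)"
      unfolding c_def Y using adjoint_mult_index[OF U(1) X, of i j] that kN by simp
    then show ?thesis unfolding BCD(4) using that BCD(1-3) by simp
  qed
  have inj: "inj_on c {..<k}"
  proof (rule inj_onI)
    fix i j assume "i \<in> {..<k}" "j \<in> {..<k}" "c i = c j"
    then show "i = j" using cc[of i j] cc[of i i] kN by (auto split: if_splits)
  qed
  have "fv.orthonormal (ip N) (c ` {..<k})"
    unfolding fv.orthonormal_def using cc kN inj by (auto simp: inj_on_eq_iff)
  then have "fv.independent (c ` {..<k})"
    by (intro fv.orthonormal_independent[OF hermitian_form_ip]) auto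
  then have "fv.dim (fv.span (c ` {..<k})) = k"
    using inj by (simp add: fv.dim_eq_card_independent card_image)
  moreover have "fv.span (c ` {..<k}) \<subseteq> vecs N"
    by (rule fv.span_minimal) (use U subspace_vecs in \<open>auto simp: c_def\<close>)
  moreover have "ip N x (app X y) = 0" if "x \<in> fv.span (c ` {..<k})" "y \<in> fv.span (c ` {..<k})" for x y
    by (rule isotropic_span[OF _ that]) (use cX in blast)
  ultimately show ?thesis unfolding isotropic_dim_def using fv.subspace_span by blast
qed

text \<open>The form \<open>ip N\<close> is diagonalized relative to itself, and only the
  orthonormality of the basis is kept.\<close>

lemma orthonormal_basis_exists:
  assumes T: "fv.subspace T" "T \<subseteq> vecs N"
  obtains B where "finite B" "fv.independent B" "fv.span B = T" "fv.orthonormal (ip N) B"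
proof -
  have "fv.pos_def_on (ip N) T" using pos_def_ip T(2) unfolding fv.pos_def_on_def by blast
  then show ?thesis
    using fv.simultaneous_diagonalization[OF hermitian_form_ip hermitian_form_ip T(1)
      fv.finite_dim_subset[OF finite_dim_vecs T(2)]] that by metis
qed

text \<open>Orthonormal bases of \<open>S\<close> and of its orthogonal complement combine, since
  the projection to \<open>S\<close> splits every vector of \<open>vecs N\<close>.\<close>

lemma orthonormal_basis_extension:
  assumes S: "fv.subspace S" "S \<subseteq> vecs N"
  obtains f where "\<And>i. i < N \<Longrightarrow> f i \<in> vecs N" "\<And>i. i < fv.dim S \<Longrightarrow> f i \<in> S"
    "\<And>i j. i < N \<Longrightarrow> j < N \<Longrightarrow> ip N (f i) (f j) = (if i = j then 1 else 0)" "fv.dim S \<le> N"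
proof -
  obtain B1 where B1: "finite B1" "fv.independent B1" "fv.span B1 = S" "fv.orthonormal (ip N) B1"
    using orthonormal_basis_exists[OF S] .
  let ?P = "{x\<in>vecs N. \<forall>v\<in>B1. ip N v x = 0}"
  have "fv.subspace ?P"
    using fv.dim_functionals_kernel[OF B1(1) subspace_vecs finite_dim_vecs, of "\<lambda>v x. ip N v x"]
    by (simp add: ip_add_right ip_scale_right)
  then obtain B2 where B2: "finite B2" "fv.independent B2" "fv.span B2 = ?P" "fv.orthonormal (ip N) B2"
    using orthonormal_basis_exists[of ?P N] by blast
  have b1: "v \<in> S" "v \<in> vecs N" if "v \<in> B1" for v using that B1(3) S(2) fv.span_base by blast+
  have b2: "w \<in> vecs N" "\<And>v. v \<in> B1 \<Longrightarrow> ip N v w = 0" if "w \<in> B2" for w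
    using fv.span_base[OF that] B2(3) by auto
  have b2': "ip N w v = 0" if "w \<in> B2" "v \<in> B1" for v w
    using b2(2)[OF that] ip_cnj[of N w v] by simp
  have disj: "B1 \<inter> B2 = {}"
    using b2 B1(4) unfolding fv.orthonormal_def by fastforce
  have on: "fv.orthonormal (ip N) (B1 \<union> B2)"
    using B1(4) B2(4) b2 b2' disj unfolding fv.orthonormal_def by auto
  have "fv.span (B1 \<union> B2) = vecs N"
  proof
    show "fv.span (B1 \<union> B2) \<subseteq> vecs N"
      by (rule fv.span_minimal) (use b1 b2 subspace_vecs in auto)
    show "vecs N \<subseteq> fv.span (B1 \<union> B2)"
    proof
      fix x assume x: "x \<in> vecs N"
      define s where "s = (\<Sum>v\<in>B1. fscale (ip N v x) v)"
      have "s \<in> fv.span B1" unfolding s_def by (intro fv.span_sum fv.span_scale fv.span_base)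
      then have sS: "s \<in> S" using B1(3) by simp
      have "ip N v s = ip N v x" if "v \<in> B1" for v
      proof -
        have "ip N v s = (\<Sum>w\<in>B1. ip N w x * ip N v w)"
          unfolding s_def by (simp add: fv.form_sum_right[OF hermitian_form_ip] ip_scale_right)
        also have "\<dots> = (\<Sum>w\<in>B1. if w = v then ip N v x else 0)"
          by (rule sum.cong) (use B1(4) that in \<open>auto simp: fv.orthonormal_def\<close>)
        finally show ?thesis using B1(1) that by simp
      qed
      then have "x - s \<in> ?P"
        using x sS S(2) subspace_vecs
        by (auto simp: fv.subspace_diff ip_def algebra_simps sum_subtractf)
      then have "x - s \<in> fv.span (B1 \<union> B2)"
        using B2(3) fv.span_mono[of B2 "B1 \<union> B2"] by blast
      moreover have "s \<in> fv.span (B1 \<union> B2)"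
        using \<open>s \<in> fv.span B1\<close> fv.span_mono[of B1 "B1 \<union> B2"] by blast
      ultimately show "x \<in> fv.span (B1 \<union> B2)" using fv.span_add[of "x - s" _ s] by simp
    qed
  qed
  moreover have "fv.independent (B1 \<union> B2)"
    by (rule fv.orthonormal_independent[OF hermitian_form_ip _ on]) (use B1 B2 in simp)
  ultimately have cardU: "card (B1 \<union> B2) = N"
    using fv.dim_span_eq_card_independent[of "B1 \<union> B2"] dim_vecs by simp
  have cardS: "card B1 = fv.dim S" using fv.dim_span_eq_card_independent[OF B1(2)] B1(3) by simp
  have cards: "card B1 + card B2 = N" using cardU card_Un_disjoint[OF B1(1) B2(1) disj] by simp
  obtain f1 where f1: "bij_betw f1 {0..<card B1} B1" using ex_bij_betw_nat_finite[OF B1(1)] by metis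
  obtain f2 where f2: "bij_betw f2 {0..<card B2} B2" using ex_bij_betw_nat_finite[OF B2(1)] by metis
  \<comment> \<open>The basis of \<open>S\<close> is numbered first, so that it will produce the
    leading block.\<close>
  define f where "f i = (if i < card B1 then f1 i else f2 (i - card B1))" for i
  have fi1: "f i \<in> B1" if "i < card B1" for i using that f1 by (auto simp: f_def bij_betw_def)
  have fi2: "f i \<in> B2" if "\<not> i < card B1" "i < N" for i
  proof -
    have "i - card B1 < card B2" using that cards by simp
    then show ?thesis using that f2 by (auto simp: f_def bij_betw_def)
  qed
  have inj: "f i = f j \<longleftrightarrow> i = j" if "i < N" "j < N" for i j
  proof (cases "i < card B1"; cases "j < card B1")
    assume "i < card B1" "j < card B1"
    then show ?thesis using f1 inj_on_eq_iff[of f1 "{0..<card B1}"] by (simp add: f_def bij_betw_def)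
  next
    assume *: "\<not> i < card B1" "\<not> j < card B1"
    then have "i - card B1 < card B2" "j - card B1 < card B2" using that cards by auto
    then have "f2 (i - card B1) = f2 (j - card B1) \<longleftrightarrow> i - card B1 = j - card B1"
      using f2 inj_on_eq_iff[of f2 "{0..<card B2}"] by (simp add: bij_betw_def)
    then show ?thesis using * by (auto simp: f_def)
  qed (use fi1 fi2 that disj in \<open>metis disjoint_iff\<close>)+
  have fU: "f i \<in> B1 \<union> B2" if "i < N" for i using fi1 fi2 that by blast
  show ?thesis
  proof (rule that)
    show "f i \<in> vecs N" if "i < N" for i using fU[OF that] b1 b2 by blast
    show "f i \<in> S" if "i < fv.dim S" for i using fi1 that cardS b1 by simp
    show "ip N (f i) (f j) = (if i = j then 1 else 0)" if "i < N" "j < N" for i j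
      using on fU inj that unfolding fv.orthonormal_def by simp
    show "fv.dim S \<le> N" using cardS cards by simp
  qed
qed

text \<open>An orthonormal basis of \<open>vecs N\<close> whose first \<open>k\<close> vectors lie
  in the isotropic subspace gives the columns of the required unitary matrix.\<close>

lemma isotropic_dim_imp_zero_block:
  assumes X: "X \<in> carrier_mat N N" and iso: "isotropic_dim N X k"
  shows "\<exists>Y. unitarily_similar X Y \<and> has_leading_zero_block k Y"
proof -
  obtain S where S: "fv.subspace S" "S \<subseteq> vecs N" and z: "\<And>x y. x \<in> S \<Longrightarrow> y \<in> S \<Longrightarrow> ip N x (app X y) = 0"
    and dS: "fv.dim S = k"
    using iso unfolding isotropic_dim_def by blast
  obtain f where f: "\<And>i. i < N \<Longrightarrow> f i \<in> vecs N" "\<And>i. i < k \<Longrightarrow> f i \<in> S"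
    "\<And>i j. i < N \<Longrightarrow> j < N \<Longrightarrow> ip N (f i) (f j) = (if i = j then 1 else 0)" "k \<le> N"
    using orthonormal_basis_extension[OF S] dS by metis
  define U where "U = mat_of_funs N f"
  have U: "U \<in> carrier_mat N N" unfolding U_def by simp
  have UU: "mat_adjoint U * U = 1\<^sub>m N" unfolding U_def by (rule unitary_of_orthonormal) (use f in auto)
  define Y where "Y = mat_adjoint U * X * U"
  have Yc: "Y \<in> carrier_mat N N" unfolding Y_def using U X by (intro mult_carrier_mat) auto
  have "unitarily_similar X Y"
    unfolding unitarily_similar_def unitary_mat_def Y_def using U X UU by (intro exI[of _ U]) auto
  moreover have Y0: "Y $$ (i, j) = 0" if "i < k" "j < k" for i j
    unfolding Y_def adjoint_mult_index[OF U X order.strict_trans2[OF that(1) f(4)] order.strict_trans2[OF that(2) f(4)]]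
    using that f z by (simp add: U_def app_mat_of_funs)
  have "has_leading_zero_block k Y"
    unfolding has_leading_zero_block_def
  proof (intro exI conjI)
    let ?r = "N - k"
    show "mat k ?r (\<lambda>(i, j). Y $$ (i, j + k)) \<in> carrier_mat k ?r" by simp
    show "mat ?r k (\<lambda>(i, j). Y $$ (i + k, j)) \<in> carrier_mat ?r k" by simp
    show "mat ?r ?r (\<lambda>(i, j). Y $$ (i + k, j + k)) \<in> carrier_mat ?r ?r" by simp
    show "Y = four_block_mat (0\<^sub>m k k) (mat k ?r (\<lambda>(i, j). Y $$ (i, j + k)))
      (mat ?r k (\<lambda>(i, j). Y $$ (i + k, j))) (mat ?r ?r (\<lambda>(i, j). Y $$ (i + k, j + k)))"
      by (rule eq_matI) (use Yc f(4) Y0 in \<open>auto simp: four_block_mat_def Let_def\<close>)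
  qed
  ultimately show ?thesis by blast
qed

lemma zero_dilation_index_isotropic_dim:
  assumes X: "X \<in> carrier_mat N N"
  shows "isotropic_dim N X (zero_dilation_index X)"
    and "isotropic_dim N X k \<Longrightarrow> k \<le> zero_dilation_index X"
proof -
  let ?K = "{k. \<exists>Y. unitarily_similar X Y \<and> has_leading_zero_block k Y}"
  have fin: "finite ?K" by (rule zero_dilation_set_finite)
  have "?K \<noteq> {}" using zero_dilation_set_zero[OF X] by blast
  then have "zero_dilation_index X \<in> ?K"
    unfolding zero_dilation_index_def by (rule Max_in[OF fin])
  then show "isotropic_dim N X (zero_dilation_index X)"
    using zero_block_imp_isotropic_dim[OF X] by blast
  show "k \<le> zero_dilation_index X" if "isotropic_dim N X k"
    unfolding zero_dilation_index_def
    by (rule Max_ge[OF fin]) (use isotropic_dim_imp_zero_block[OF X that] in blast)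
qed

text \<open>Orthonormal bases of \<open>S\<close> and \<open>T\<close> are disjoint, and their union
  is again orthonormal, hence independent.\<close>

lemma dim_orthogonal_sum:
  assumes S: "fv.subspace S" "S \<subseteq> vecs N" and T: "fv.subspace T" "T \<subseteq> vecs N"
    and orth: "\<And>x y. x \<in> S \<Longrightarrow> y \<in> T \<Longrightarrow> ip N x y = 0"
  shows "fv.dim (fv.span (S \<union> T)) = fv.dim S + fv.dim T"
proof -
  obtain B where B: "finite B" "fv.independent B" "fv.span B = S" "fv.orthonormal (ip N) B"
    using orthonormal_basis_exists[OF S] .
  obtain C where C: "finite C" "fv.independent C" "fv.span C = T" "fv.orthonormal (ip N) C"
    using orthonormal_basis_exists[OF T] .
  have BC: "ip N v w = 0" "ip N w v = 0" if "v \<in> B" "w \<in> C" for v w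
  proof -
    show "ip N v w = 0" using orth that B(3) C(3) fv.span_base by blast
    then show "ip N w v = 0" using ip_cnj[of N w v] by simp
  qed
  have disj: "B \<inter> C = {}"
    using BC B(4) unfolding fv.orthonormal_def by fastforce
  have "fv.orthonormal (ip N) (B \<union> C)"
    using B(4) C(4) BC disj unfolding fv.orthonormal_def by auto
  then have ind: "fv.independent (B \<union> C)"
    by (rule fv.orthonormal_independent[OF hermitian_form_ip, rotated]) (use B C in simp)
  have "fv.span (S \<union> T) = fv.span (B \<union> C)"
    unfolding fv.span_Un B(3) C(3) using S(1) T(1) by (simp add: fv.span_eq_iff[THEN iffD2])
  then have "fv.dim (fv.span (S \<union> T)) = card (B \<union> C)"
    using fv.dim_span_eq_card_independent[OF ind] by simp
  then show ?thesis
    using card_Un_disjoint[OF B(1) C(1) disj] fv.dim_span_eq_card_independent[OF B(2)]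
      fv.dim_span_eq_card_independent[OF C(2)] B(3) C(3) by simp
qed

lemma in_span_Un_subspaces:
  assumes "fv.subspace S" "fv.subspace T" "x \<in> fv.span (S \<union> T)"
  obtains s t where "s \<in> S" "t \<in> T" "x = s + t"
proof -
  have "fv.span S = S" "fv.span T = T" using assms fv.span_eq_iff by auto
  moreover obtain s t where "s \<in> fv.span S" "t \<in> fv.span T" "x = s + t"
    using assms(3) unfolding fv.span_Un by blast
  ultimately show ?thesis using that by metis
qed

lemma ip_diff_right: "ip N x (y - z) = ip N x y - ip N x z"
  by (simp add: ip_def algebra_simps sum_subtractf)

lemma mat_adjoint_mult:
  assumes "A \<in> carrier_mat n m" "B \<in> carrier_mat m l"
  shows "mat_adjoint (A * B :: complex mat) = mat_adjoint B * mat_adjoint A"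
  by (rule eq_matI) (use assms in \<open>auto simp: scalar_prod_def intro!: sum.cong\<close>)

lemma mat_adjoint_minus:
  "A \<in> carrier_mat n m \<Longrightarrow> B \<in> carrier_mat n m \<Longrightarrow>
    mat_adjoint (A - B :: complex mat) = mat_adjoint A - mat_adjoint B"
  by (rule eq_matI) auto

lemma mat_adjoint_smult: "mat_adjoint (c \<cdot>\<^sub>m A :: complex mat) = cnj c \<cdot>\<^sub>m mat_adjoint A"
  by (rule eq_matI) auto

lemma mat_adjoint_one: "mat_adjoint (1\<^sub>m n :: complex mat) = 1\<^sub>m n"
  by (rule eq_matI) auto

section \<open>Graded matrices\<close>

text \<open>Abstracts \<open>J\<^sub>m(0) \<otimes> A\<close>, with the block index as degree:
  \<open>T\<close> takes coordinates of degree \<open>d + 1\<close> to coordinates of degree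
  \<open>d\<close>, and its adjoint goes the other way.\<close>

locale graded_matrix =
  fixes N :: nat and T :: "complex mat" and deg :: "nat \<Rightarrow> nat"
  assumes T: "T \<in> carrier_mat N N"
    and graded: "i < N \<Longrightarrow> j < N \<Longrightarrow> T $$ (i, j) \<noteq> 0 \<Longrightarrow> deg j = deg i + 1"
begin

abbreviation "Ts \<equiv> mat_adjoint T"

lemma Ts: "Ts \<in> carrier_mat N N"
  using T by simp

text \<open>A diagonal matrix that is constant on each degree. The weights are real, which makes it
  self-adjoint. The uses below are the powers \<open>z ^ d\<close> and the projection onto a single
  degree.\<close>

definition dil :: "(nat \<Rightarrow> real) \<Rightarrow> (nat \<Rightarrow> complex) \<Rightarrow> nat \<Rightarrow> complex" where
  "dil \<phi> x = (\<lambda>i. complex_of_real (\<phi> (deg i)) * x i)"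

lemma dil_vecs: "x \<in> vecs N \<Longrightarrow> dil \<phi> x \<in> vecs N"
  by (simp add: dil_def vecs_def)

lemma ip_dil: "ip N (dil \<phi> x) y = ip N x (dil \<phi> y)"
  by (simp add: ip_def dil_def mult_ac)

lemma dil_dil: "dil \<phi> (dil \<psi> x) = dil (\<lambda>d. \<phi> d * \<psi> d) x"
  by (simp add: dil_def mult_ac)

lemma dil_zero: "dil \<phi> 0 = 0"
  by (rule ext) (simp add: dil_def)

lemma dil_scale: "dil \<phi> (fscale c x) = fscale c (dil \<phi> x)"
  by (rule ext) (simp add: dil_def algebra_simps)

lemma dil_sum: "dil \<phi> (\<Sum>i\<in>I. f i) = (\<Sum>i\<in>I. dil \<phi> (f i))"
  by (rule ext) (simp add: dil_def sum_apply sum_distrib_left)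

lemma dil_mult_const: "dil (\<lambda>d. c * \<phi> d) x = fscale (complex_of_real c) (dil \<phi> x)"
  by (rule ext) (simp add: dil_def)

text \<open>Each nonzero entry in row \<open>i\<close> has a column of degree
  \<open>Suc (deg i)\<close>, so all of its terms carry the same weight.\<close>

lemma T_dil: "app T (dil \<phi> x) = dil (\<lambda>d. \<phi> (Suc d)) (app T x)"
proof (rule ext)
  fix i
  show "app T (dil \<phi> x) i = dil (\<lambda>d. \<phi> (Suc d)) (app T x) i"
  proof (cases "i < N")
    case True
    have "T $$ (i, j) * (complex_of_real (\<phi> (deg j)) * x j) =
       complex_of_real (\<phi> (Suc (deg i))) * (T $$ (i, j) * x j)" if "j < N" for j
      using graded[OF True that] by (cases "T $$ (i, j) = 0") auto
    then have "(\<Sum>j<N. T $$ (i, j) * (complex_of_real (\<phi> (deg j)) * x j)) =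
       (\<Sum>j<N. complex_of_real (\<phi> (Suc (deg i))) * (T $$ (i, j) * x j))"
      by (intro sum.cong) auto
    then show ?thesis using True T by (simp add: app_def dil_def sum_distrib_left)
  qed (use T in \<open>simp add: app_def dil_def\<close>)
qed

lemma dil_Ts: "dil \<phi> (app Ts x) = app Ts (dil (\<lambda>d. \<phi> (Suc d)) x)"
proof (rule ext)
  fix i
  show "dil \<phi> (app Ts x) i = app Ts (dil (\<lambda>d. \<phi> (Suc d)) x) i"
  proof (cases "i < N")
    case True
    have "cnj (T $$ (j, i)) * (complex_of_real (\<phi> (Suc (deg j))) * x j) =
       complex_of_real (\<phi> (deg i)) * (cnj (T $$ (j, i)) * x j)" if "j < N" for j
      using graded[OF that True] by (cases "T $$ (j, i) = 0") auto
    then have "(\<Sum>j<N. cnj (T $$ (j, i)) * (complex_of_real (\<phi> (Suc (deg j))) * x j)) =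
       (\<Sum>j<N. complex_of_real (\<phi> (deg i)) * (cnj (T $$ (j, i)) * x j))"
      by (intro sum.cong) auto
    then show ?thesis using True T by (simp add: app_def dil_def sum_distrib_left)
  qed (use T in \<open>simp add: app_def dil_def\<close>)
qed

text \<open>The truncated subtraction is harmless at degree \<open>0\<close>, where
  \<open>app Ts x\<close> has only zero coordinates.\<close>

lemma Ts_dil: "app Ts (dil \<phi> x) = dil (\<lambda>d. \<phi> (d - 1)) (app Ts x)"
  by (simp add: dil_Ts)

lemma ip_T: "ip N x (app T y) = ip N (app Ts x) y"
  by (rule ip_app_adjoint[OF T])

lemma ip_Ts: "ip N x (app Ts y) = ip N (app T x) y"
  using ip_app_adjoint[OF Ts] by simp

lemma app_Ts_vecs: "app Ts x \<in> vecs N"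
  using T by auto

text \<open>\<open>pf\<close>, \<open>mf\<close>, \<open>mf'\<close> and \<open>hf\<close> are the sesquilinear forms of \<open>T T*\<close>, \<open>M = T - T T*\<close>, \<open>M*\<close> and \<open>M + M*\<close>.\<close>

definition pf :: "(nat \<Rightarrow> complex) \<Rightarrow> (nat \<Rightarrow> complex) \<Rightarrow> complex" where
  "pf x y = ip N (app Ts x) (app Ts y)"

definition mf :: "(nat \<Rightarrow> complex) \<Rightarrow> (nat \<Rightarrow> complex) \<Rightarrow> complex" where
  "mf x y = ip N x (app T y) - pf x y"

definition mf' :: "(nat \<Rightarrow> complex) \<Rightarrow> (nat \<Rightarrow> complex) \<Rightarrow> complex" where
  "mf' x y = ip N x (app Ts y) - pf x y"

definition hf :: "(nat \<Rightarrow> complex) \<Rightarrow> (nat \<Rightarrow> complex) \<Rightarrow> complex" where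
  "hf x y = mf x y + mf' x y"

lemma hermitian_form_pf: "fv.hermitian_form pf"
  unfolding fv.hermitian_form_def pf_def
proof (intro conjI allI)
  fix x y show "ip N (app Ts y) (app Ts x) = cnj (ip N (app Ts x) (app Ts y))" by (rule ip_cnj)
qed (simp_all add: app_add app_scale ip_add_right ip_scale_right)

lemma mf'_cnj: "mf' x y = cnj (mf y x)"
  unfolding mf_def mf'_def ip_Ts complex_cnj_diff
  using ip_cnj[of N "app T x" y] fv.form_cnj[OF hermitian_form_pf, of x y] by simp

lemma mf_add_right: "mf x (y + z) = mf x y + mf x z"
  and mf_scale_right: "mf x (fscale c y) = c * mf x y"
  and mf'_add_right: "mf' x (y + z) = mf' x y + mf' x z"
  and mf'_scale_right: "mf' x (fscale c y) = c * mf' x y"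
  by (simp_all add: mf_def mf'_def pf_def app_add app_scale ip_add_right ip_scale_right algebra_simps)

lemma mf_zero_right: "mf x 0 = 0" and mf'_zero_right: "mf' x 0 = 0"
  using mf_scale_right[of x 0 0] mf'_scale_right[of x 0 0] by simp_all

lemma mf_sum_right: "mf x (\<Sum>i\<in>I. f i) = (\<Sum>i\<in>I. mf x (f i))"
  and mf'_sum_right: "mf' x (\<Sum>i\<in>I. f i) = (\<Sum>i\<in>I. mf' x (f i))"
  by (induction I rule: infinite_finite_induct)
    (simp_all add: mf_add_right mf'_add_right mf_zero_right mf'_zero_right)

lemma mf_mat: "mf x y = ip N x (app (T - T * Ts) y)"
proof -
  have "app (T - T * Ts) y = app T y - app T (app Ts y)"
    using T Ts app_minus[OF T mult_carrier_mat[OF T Ts]] app_mult[OF T Ts] by simp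
  then show ?thesis by (simp add: mf_def pf_def ip_T ip_diff_right)
qed

lemma hf_mat: "hf x y = ip N x (app (T + Ts - 2 \<cdot>\<^sub>m (T * Ts)) y)"
proof -
  have "app (T + Ts - 2 \<cdot>\<^sub>m (T * Ts)) y = app T y + app Ts y - fscale 2 (app T (app Ts y))"
    using app_minus[of "T + Ts" N N "2 \<cdot>\<^sub>m (T * Ts)"] T Ts
    by (simp add: app_plus[OF T Ts] app_mult[OF T Ts] app_smult)
  then show ?thesis
    by (simp add: hf_def mf_def mf'_def pf_def ip_T[symmetric] ip_diff_right ip_add_right ip_scale_right)
qed

lemma hermitian_form_hf: "fv.hermitian_form hf"
  unfolding fv.hermitian_form_def hf_def mf'_cnj[of _ "_"]
proof (intro conjI allI)
  fix x y z c
  show "mf x (y + z) + cnj (mf (y + z) x) = mf x y + cnj (mf y x) + (mf x z + cnj (mf z x))"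
    unfolding mf'_cnj[symmetric] mf_add_right mf'_add_right by simp
  show "mf x (fscale c y) + cnj (mf (fscale c y) x) = c * (mf x y + cnj (mf y x))"
    unfolding mf'_cnj[symmetric] mf_scale_right mf'_scale_right by (simp add: distrib_left)
  show "mf y x + cnj (mf x y) = cnj (mf x y + cnj (mf y x))" by simp
qed

section \<open>The kernel of the adjoint and the reduced space \<open>L\<close>\<close>

definition Ker :: "(nat \<Rightarrow> complex) set" where
  "Ker = {x \<in> vecs N. app Ts x = 0}"

text \<open>Two kinds of orthogonality to \<open>Ker\<close>: the first condition is for the inner
  product, the second for \<open>hf\<close>, as \<open>hf_Ker_left\<close> shows.\<close>

definition L :: "(nat \<Rightarrow> complex) set" where
  "L = {x \<in> vecs N. \<forall>\<kappa>\<in>Ker. ip N \<kappa> x = 0 \<and> ip N (app T \<kappa>) x = 0}"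

lemma subspace_Ker: "fv.subspace Ker"
  unfolding Ker_def using subspace_vecs[of N]
  by (auto intro!: fv.subspaceI simp: app_add app_scale fv.subspace_0 fv.subspace_add fv.subspace_scale)

lemma subspace_L: "fv.subspace L"
  unfolding L_def using subspace_vecs[of N]
  by (auto intro!: fv.subspaceI simp: ip_add_right ip_scale_right fv.subspace_0 fv.subspace_add fv.subspace_scale)

lemma Ker_vecs: "Ker \<subseteq> vecs N" and L_vecs: "L \<subseteq> vecs N"
  unfolding Ker_def L_def by auto

lemma finite_dim_Ker: "fv.finite_dim Ker" and finite_dim_L: "fv.finite_dim L"
  using fv.finite_dim_subset[OF finite_dim_vecs] Ker_vecs L_vecs by blast+

lemma Ker_L_orthogonal: "\<kappa> \<in> Ker \<Longrightarrow> x \<in> L \<Longrightarrow> ip N \<kappa> x = 0"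
  by (simp add: L_def)

lemma dil_Ker: "x \<in> Ker \<Longrightarrow> dil \<phi> x \<in> Ker"
  unfolding Ker_def by (simp add: dil_vecs Ts_dil dil_zero)

text \<open>A dilation can be moved across the inner product onto \<open>\<kappa>\<close> or
  \<open>app T \<kappa>\<close>, and \<open>Ker\<close> is closed under dilations. Thus
  \<open>L\<close> is a graded subspace.\<close>

lemma dil_L: assumes "x \<in> L" shows "dil \<phi> x \<in> L"
proof -
  have "ip N \<kappa> (dil \<phi> x) = 0" "ip N (app T \<kappa>) (dil \<phi> x) = 0" if "\<kappa> \<in> Ker" for \<kappa>
  proof -
    show "ip N \<kappa> (dil \<phi> x) = 0"
      using assms dil_Ker[OF that] unfolding ip_dil[symmetric] L_def by blast
    \<comment> \<open>The weight is shifted down so that \<open>T_dil\<close> turns it back into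
      \<open>\<phi>\<close>.\<close>
    have "ip N (app T \<kappa>) (dil \<phi> x) = ip N (app T (dil (\<lambda>d. \<phi> (d - 1)) \<kappa>)) x"
      by (simp add: T_dil ip_dil)
    then show "ip N (app T \<kappa>) (dil \<phi> x) = 0"
      using assms dil_Ker[OF that] unfolding L_def by simp
  qed
  then show ?thesis using assms dil_vecs unfolding L_def by blast
qed

text \<open>The product of \<open>T\<close> and its adjoint preserves degrees, so it commutes with
  dilations.\<close>

lemma pf_dil: "pf x (dil \<phi> y) = pf (dil \<phi> x) y"
proof -
  have "pf x (dil \<phi> y) = ip N x (app T (app Ts (dil \<phi> y)))"
    by (simp add: pf_def ip_T)
  also have "app T (app Ts (dil \<phi> y)) = dil \<phi> (app T (app Ts y))"
    unfolding Ts_dil T_dil by simp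
  also have "ip N x (dil \<phi> (app T (app Ts y))) = pf (dil \<phi> x) y"
    by (simp add: pf_def ip_T ip_dil[symmetric])
  finally show ?thesis .
qed

text \<open>The left argument enters \<open>mf\<close> only through its image under
  \<open>Ts\<close>, which is zero on \<open>Ker\<close>.\<close>

lemma mf_Ker_left: "\<kappa> \<in> Ker \<Longrightarrow> mf \<kappa> y = 0"
  by (simp add: mf_def pf_def ip_T Ker_def)

lemma mf_Ker_right: "\<kappa> \<in> Ker \<Longrightarrow> mf x \<kappa> = ip N x (app T \<kappa>)"
  by (simp add: mf_def pf_def Ker_def)

lemma mf_L_Ker: "\<kappa> \<in> Ker \<Longrightarrow> x \<in> L \<Longrightarrow> mf x \<kappa> = 0"
  using ip_cnj[of N x "app T \<kappa>"] by (simp add: mf_Ker_right L_def)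

lemma hf_Ker_left: "\<kappa> \<in> Ker \<Longrightarrow> hf \<kappa> x = ip N (app T \<kappa>) x"
  using ip_cnj[of N "app T \<kappa>" x] by (simp add: hf_def mf'_cnj mf_Ker_left mf_Ker_right)

lemma hf_Ker_Ker: "\<kappa> \<in> Ker \<Longrightarrow> \<kappa>' \<in> Ker \<Longrightarrow> hf \<kappa> \<kappa>' = 0"
  by (simp add: hf_def mf'_cnj mf_Ker_left)

lemma hf_Ker_L: "\<kappa> \<in> Ker \<Longrightarrow> x \<in> L \<Longrightarrow> hf \<kappa> x = 0"
  by (simp add: hf_Ker_left L_def)

text \<open>A vector of \<open>L\<close> annihilated by \<open>Ts\<close> lies in \<open>Ker\<close>
  as well, hence is orthogonal to itself.\<close>

lemma pos_def_pf_L: "fv.pos_def_on pf L"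
  unfolding fv.pos_def_on_def
proof (intro ballI impI)
  fix x assume x: "x \<in> L" "x \<noteq> 0"
  then have xv: "x \<in> vecs N" using L_vecs by blast
  have "app Ts x \<noteq> 0"
  proof
    assume "app Ts x = 0"
    then have "x \<in> Ker" using xv unfolding Ker_def by simp
    then have "ip N x x = 0" using x Ker_L_orthogonal by blast
    then show False using ip_self_eq_0[OF xv] x by simp
  qed
  then show "0 < Re (pf x x)"
    using pos_def_ip app_Ts_vecs unfolding pf_def fv.pos_def_on_def by blast
qed

text \<open>\<open>Ker\<close> is first absorbed into the nonnegative subspace. Passing to the
  vectors orthogonal to \<open>Ker\<close> then costs at most \<open>dim Ker\<close>, and what
  remains satisfies the second condition of \<open>L\<close> automatically.\<close>

lemma nonneg_reduce_to_L:
  assumes S: "fv.subspace S" "S \<subseteq> vecs N" "fv.nonneg_on hf S"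
  obtains S1 where "fv.subspace S1" "S1 \<subseteq> L" "fv.nonneg_on hf S1" "fv.dim S \<le> fv.dim S1 + fv.dim Ker"
proof -
  have fdS: "fv.finite_dim S" using fv.finite_dim_subset[OF finite_dim_vecs S(2)] .
  obtain S' where S': "fv.subspace S'" "fv.finite_dim S'" "fv.nonneg_on hf S'" "Ker \<subseteq> S'"
    "fv.dim S \<le> fv.dim S'" "S' \<subseteq> fv.span (S \<union> Ker)"
    using fv.nonneg_absorb_isotropic[OF hermitian_form_hf S(1) fdS S(3) subspace_Ker finite_dim_Ker hf_Ker_Ker]
    by blast
  have S'v: "S' \<subseteq> vecs N"
    using S'(6) fv.span_minimal[of "S \<union> Ker" "vecs N"] S(2) Ker_vecs subspace_vecs by blast
  obtain B where B: "finite B" "fv.independent B" "B \<subseteq> Ker" "fv.span B = Ker" "card B = fv.dim Ker"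
    using fv.subspace_basis[OF subspace_Ker finite_dim_Ker] .
  let ?S1 = "{x\<in>S'. \<forall>v\<in>B. ip N v x = 0}"
  have S1: "fv.subspace ?S1 \<and> fv.dim S' \<le> fv.dim ?S1 + card B"
    by (rule fv.dim_functionals_kernel[OF B(1) S'(1,2)]) (simp_all add: ip_add_right ip_scale_right)
  have "?S1 \<subseteq> L"
  proof
    fix x assume x: "x \<in> ?S1"
    have "ip N \<kappa> x = 0" if "\<kappa> \<in> fv.span B" for \<kappa>
      using that
    proof (induction rule: fv.span_induct_alt)
      case base
      show ?case by (rule ip_zero_left)
    next
      case (step c v y)
      then show ?case using x by (simp only: ip_add_left ip_scale_left) simp
    qed
    \<comment> \<open>Isotropic vectors of a nonnegative subspace are \<open>hf\<close>-orthogonal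
      to all of it, and \<open>hf\<close> against \<open>\<kappa>\<close> is this inner
      product.\<close>
    moreover have "ip N (app T \<kappa>) x = 0" if k: "\<kappa> \<in> Ker" for \<kappa>
      using fv.nonneg_isotropic_orthogonal[OF hermitian_form_hf S'(1,3), of \<kappa> x] k S'(4) x
        hf_Ker_Ker[OF k k] hf_Ker_left[OF k] by auto
    ultimately show "x \<in> L" using x S'v B(4) unfolding L_def by blast
  qed
  moreover have "fv.nonneg_on hf ?S1" using S'(3) unfolding fv.nonneg_on_def by blast
  moreover have "fv.dim S \<le> fv.dim ?S1 + fv.dim Ker" using S1 S'(5) B(5) by linarith
  ultimately show ?thesis using S1 that by blast
qed

text \<open>\<open>Ker\<close> is \<open>hf\<close>-isotropic and \<open>hf\<close>-orthogonal to
  \<open>L\<close>, so adding it leaves the values of the form unchanged. This is the converse of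
  \<open>nonneg_reduce_to_L\<close>.\<close>

lemma nonneg_extend_by_Ker:
  assumes S: "fv.subspace S" "S \<subseteq> L" "fv.nonneg_on hf S"
  shows "fv.nonneg_on hf (fv.span (Ker \<union> S))" "fv.dim (fv.span (Ker \<union> S)) = fv.dim Ker + fv.dim S"
    "fv.span (Ker \<union> S) \<subseteq> vecs N"
proof -
  show "fv.nonneg_on hf (fv.span (Ker \<union> S))"
    unfolding fv.nonneg_on_def
  proof
    fix x assume "x \<in> fv.span (Ker \<union> S)"
    then obtain k s where ks: "k \<in> Ker" "s \<in> S" "x = k + s"
      using in_span_Un_subspaces[OF subspace_Ker S(1)] by metis
    have 1: "hf k s = 0" using hf_Ker_L ks S(2) by blast
    then have "hf s k = 0" using fv.form_cnj[OF hermitian_form_hf, of s k] by simp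
    then have "hf x x = hf s s"
      unfolding ks(3) fv.form_add_left[OF hermitian_form_hf] fv.form_add_right[OF hermitian_form_hf]
      using 1 hf_Ker_Ker[OF ks(1) ks(1)] by simp
    then show "0 \<le> Re (hf x x)" using S(3) ks(2) unfolding fv.nonneg_on_def by simp
  qed
  show "fv.dim (fv.span (Ker \<union> S)) = fv.dim Ker + fv.dim S"
    by (rule dim_orthogonal_sum) (use subspace_Ker Ker_vecs S L_vecs Ker_L_orthogonal in blast)+
  show "fv.span (Ker \<union> S) \<subseteq> vecs N"
    by (rule fv.span_minimal) (use Ker_vecs S L_vecs subspace_vecs in auto)
qed

text \<open>On \<open>L\<close> this form is block triangular for the degree: \<open>Ts\<close>
  raises the degree, while the term \<open>pf\<close> preserves it and is positive definite. The
  components of \<open>y\<close> therefore vanish one degree after another.\<close>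

lemma mf'_nondegenerate:
  assumes y: "y \<in> L" and z: "\<And>x. x \<in> L \<Longrightarrow> mf' x y = 0"
  shows "y = 0"
proof -
  let ?P = "\<lambda>d. dil (\<lambda>e. if e = d then 1 else 0)"
  have "?P d y = 0" for d
  proof (induction d rule: less_induct)
    case (less d)
    have PL: "?P d y \<in> L" by (rule dil_L[OF y])
    \<comment> \<open>Only the component of \<open>y\<close> of degree \<open>d - 1\<close>
      contributes; it is zero by induction, and there is none when \<open>d = 0\<close>.\<close>
    have "ip N (?P d y) (app Ts y) = 0"
    proof (cases d)
      case 0
      have "?P d (app Ts y) = app Ts (dil (\<lambda>e. 0) y)" unfolding dil_Ts 0 by simp
      also have "dil (\<lambda>e. 0) y = 0" by (rule ext) (simp add: dil_def)
      finally show ?thesis by (simp only: ip_dil app_zero ip_zero_right)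
    next
      case (Suc c)
      have "?P d (app Ts y) = app Ts (?P c y)" unfolding dil_Ts Suc by simp
      also have "?P c y = 0" by (rule less) (simp add: Suc)
      finally show ?thesis by (simp only: ip_dil app_zero ip_zero_right)
    qed
    moreover have "mf' (?P d y) y = 0" by (rule z[OF PL])
    ultimately have "pf (?P d y) y = 0" by (simp add: mf'_def)
    moreover have "pf (?P d y) (?P d y) = pf (?P d y) y"
      unfolding pf_dil dil_dil by (rule arg_cong[where f = "\<lambda>x. pf x y"]) (auto simp: dil_def)
    ultimately have "pf (?P d y) (?P d y) = 0" by simp
    then show ?case using pos_def_pf_L PL unfolding fv.pos_def_on_def by force
  qed
  then have "?P (deg i) y i = 0" for i by (simp add: fun_eq_iff)
  then show ?thesis by (auto simp: dil_def fun_eq_iff)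
qed

section \<open>Twisted vectors: eigenvectors, for the value \<open>-z\<^sup>2\<close>, of the pencil
  of \<open>M\<close> and its adjoint compressed to \<open>L\<close>\<close>

definition twisted :: "real \<Rightarrow> (nat \<Rightarrow> complex) \<Rightarrow> bool" where
  "twisted z y \<longleftrightarrow> y \<in> L \<and> (\<forall>x\<in>L. mf x y = - (complex_of_real z)\<^sup>2 * mf' x y)"

lemma twisted_scale: "twisted z y \<Longrightarrow> twisted z (fscale c y)"
  unfolding twisted_def using subspace_L by (auto simp: fv.subspace_scale mf_scale_right mf'_scale_right)

lemma twisted_sum:
  "(\<And>i. i \<in> I \<Longrightarrow> twisted z (f i)) \<Longrightarrow> twisted z (\<Sum>i\<in>I. f i)"
  unfolding twisted_def using subspace_L
  by (auto simp: fv.subspace_sum mf_sum_right mf'_sum_right sum_distrib_left sum_negf intro!: sum.cong)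

text \<open>Eigenvectors of a pencil for distinct eigenvalues are independent, because the second
  form is nondegenerate. Positivity of the parameters makes their squares distinct.\<close>

lemma twisted_sum_eq_0:
  assumes "finite Z" "\<And>z. z \<in> Z \<Longrightarrow> 0 < z" "\<And>z. z \<in> Z \<Longrightarrow> twisted z (e z)" "(\<Sum>z\<in>Z. e z) = 0"
  shows "\<forall>z\<in>Z. e z = 0"
  using assms
proof (induction Z arbitrary: e rule: finite_induct)
  case (insert a Z)
  let ?c = "\<lambda>z. complex_of_real (a\<^sup>2 - z\<^sup>2)"
  \<comment> \<open>The coefficients eliminate the summand \<open>e a\<close>: the twisting
    relations make \<open>mf'\<close> vanish at the sum of the \<open>f z\<close>, so nondegeneracy
    and induction apply.\<close>
  define f where "f z = fscale (?c z) (e z)" for z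
  have tf: "twisted z (f z)" if "z \<in> Z" for z
    unfolding f_def using insert.prems(2) that by (intro twisted_scale) simp
  have sumL: "(\<Sum>z\<in>Z. f z) \<in> L"
    using tf subspace_L unfolding twisted_def by (intro fv.subspace_sum) auto
  have e0: "(\<Sum>z\<in>Z. e z) = - e a"
    using insert.prems(3) insert.hyps by (metis sum.insert add.commute eq_neg_iff_add_eq_0)
  have "mf' x (\<Sum>z\<in>Z. f z) = 0" if x: "x \<in> L" for x
  proof -
    have tw: "mf x (e z) = - (complex_of_real z)\<^sup>2 * mf' x (e z)" if "z \<in> insert a Z" for z
      using insert.prems(2)[OF that] x unfolding twisted_def by blast
    have "mf' x (\<Sum>z\<in>Z. f z) = (\<Sum>z\<in>Z. (complex_of_real a)\<^sup>2 * mf' x (e z) + mf x (e z))"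
      unfolding mf'_sum_right f_def mf'_scale_right
      by (rule sum.cong) (simp_all add: tw algebra_simps)
    also have "\<dots> = (complex_of_real a)\<^sup>2 * mf' x (- e a) + mf x (- e a)"
      unfolding e0[symmetric] mf'_sum_right mf_sum_right by (simp add: sum.distrib sum_distrib_left)
    also have "- e a = fscale (-1) (e a)" by (rule ext) simp
    also have "(complex_of_real a)\<^sup>2 * mf' x (fscale (-1) (e a)) + mf x (fscale (-1) (e a)) = 0"
      unfolding mf_scale_right mf'_scale_right using tw[of a] by simp
    finally show ?thesis .
  qed
  then have "(\<Sum>z\<in>Z. f z) = 0" by (rule mf'_nondegenerate[OF sumL])
  then have f0: "\<forall>z\<in>Z. f z = 0"
    by (intro insert.IH) (use insert.prems tf in auto)
  have eZ: "e z = 0" if z: "z \<in> Z" for z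
  proof -
    have "z \<noteq> a" "0 < z" "0 < a" using z insert.hyps insert.prems(1) by auto
    then have "a\<^sup>2 - z\<^sup>2 \<noteq> 0" by (simp add: power2_eq_iff)
    then show ?thesis using f0 z unfolding f_def by (metis fv.scale_eq_0_iff of_real_eq_0_iff)
  qed
  then have "(\<Sum>z\<in>Z. e z) = 0" by (intro sum.neutral) blast
  then have "- e a = 0" using e0 by metis
  then have "e a = 0" by (metis neg_equal_0_iff_equal)
  then show ?case using eZ by blast
qed simp

text \<open>The two relations, combined with \<open>mf'\<close> being the conjugate transpose of
  \<open>mf\<close>, give \<open>mf x y = (z * w)\<^sup>2 * mf x y\<close>.\<close>

lemma twisted_isotropic:
  assumes "twisted z x" "twisted w y" "0 < z" "0 < w" "z * w \<noteq> 1"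
  shows "mf x y = 0"
proof -
  have "mf x y = - (complex_of_real w)\<^sup>2 * cnj (mf y x)"
    using assms(1,2) unfolding twisted_def mf'_cnj[symmetric] by blast
  also have "mf y x = - (complex_of_real z)\<^sup>2 * cnj (mf x y)"
    using assms(1,2) unfolding twisted_def mf'_cnj[symmetric] by blast
  finally have "mf x y = complex_of_real ((z * w)\<^sup>2) * mf x y"
    by (simp add: power_mult_distrib mult_ac)
  then have "complex_of_real ((z * w)\<^sup>2 - 1) * mf x y = 0" by (simp add: algebra_simps)
  moreover have "(z * w)\<^sup>2 - 1 \<noteq> 0"
    using assms(3-5) by (simp add: power2_eq_1_iff) (smt (verit) mult_pos_pos)
  ultimately show ?thesis by (simp del: of_real_diff of_real_power)
qed

text \<open>The degree shift turns \<open>w ^ d\<close> into \<open>w ^ Suc d\<close>, which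
  accounts for the single factor \<open>w\<close>.\<close>

lemma dil_power_forms:
  assumes w: "0 < w"
  shows "ip N x (app T (dil (\<lambda>d. w ^ d) v)) = complex_of_real w * ip N (dil (\<lambda>d. w ^ d) x) (app T v)"
    and "complex_of_real w * ip N x (app Ts (dil (\<lambda>d. w ^ d) v)) = ip N (dil (\<lambda>d. w ^ d) x) (app Ts v)"
proof -
  show "ip N x (app T (dil (\<lambda>d. w ^ d) v)) = complex_of_real w * ip N (dil (\<lambda>d. w ^ d) x) (app T v)"
    by (simp add: T_dil dil_mult_const ip_scale_right ip_dil)
  have "ip N (dil (\<lambda>d. w ^ d) x) (app Ts v) = ip N x (app Ts (dil (\<lambda>d. w * w ^ d) v))"
    by (simp add: ip_dil dil_Ts)
  also have "\<dots> = complex_of_real w * ip N x (app Ts (dil (\<lambda>d. w ^ d) v))"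
    unfolding dil_mult_const app_scale ip_scale_right ..
  finally show "complex_of_real w * ip N x (app Ts (dil (\<lambda>d. w ^ d) v)) = ip N (dil (\<lambda>d. w ^ d) x) (app Ts v)"
    by simp
qed

text \<open>With \<open>a\<close>, \<open>b\<close>, \<open>p\<close> the values of
  \<open>T\<close>, \<open>Ts\<close> and \<open>pf\<close> at the dilated test vector, the
  eigenvalue equation reads \<open>a + b = (z + 1 / z) * p\<close>. The form \<open>mf\<close> of
  the new vector is \<open>z * a - p\<close> and \<open>z\<^sup>2\<close> times \<open>mf'\<close>
  is \<open>z * b - z\<^sup>2 * p\<close>; these add up to zero.\<close>

lemma twisted_dil:
  assumes v: "v \<in> L" and ev: "\<And>x. x \<in> L \<Longrightarrow> hf x v = complex_of_real nu * pf x v"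
    and z: "0 < z" "z + 1 / z = nu + 2"
  shows "twisted z (dil (\<lambda>d. z ^ d) v)"
  unfolding twisted_def
proof (intro conjI ballI)
  let ?D = "dil (\<lambda>d. z ^ d)"
  show "?D v \<in> L" by (rule dil_L[OF v])
  fix x assume x: "x \<in> L"
  define a where "a = ip N (?D x) (app T v)"
  define b where "b = ip N (?D x) (app Ts v)"
  define p where "p = pf (?D x) v"
  let ?z = "complex_of_real z"
  have zn: "?z \<noteq> 0" using z by simp
  have "a + b = complex_of_real (nu + 2) * p"
    using ev[OF dil_L[OF x]] unfolding hf_def mf_def mf'_def a_def b_def p_def by (simp add: algebra_simps)
  then have ab: "a + b = (?z + 1 / ?z) * p" unfolding z(2)[symmetric] by simp
  have "mf x (?D v) = ?z * a - p"
    unfolding mf_def dil_power_forms(1)[OF z(1)] pf_dil a_def p_def ..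
  moreover have "?z * mf' x (?D v) = b - ?z * p"
    unfolding mf'_def right_diff_distrib dil_power_forms(2)[OF z(1)] pf_dil b_def p_def ..
  then have "?z\<^sup>2 * mf' x (?D v) = ?z * (b - ?z * p)" by (simp add: power2_eq_square)
  moreover have "b = (?z + 1 / ?z) * p - a" using ab by (simp add: algebra_simps)
  then have "?z * (b - ?z * p) = p - ?z * a" using zn by (simp add: field_simps)
  ultimately show "mf x (?D v) = - ?z\<^sup>2 * mf' x (?D v)" by simp
qed

text \<open>Covers the case \<open>z * w = 1\<close> left open by \<open>twisted_isotropic\<close>.
  For parameters at least \<open>1\<close> it means \<open>z = w = 1\<close>, that is, two
  eigenvectors of relative eigenvalue zero.\<close>

lemma mf_null_pair:
  assumes u: "u \<in> L" and v: "v \<in> L"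
    and hu: "\<And>x. x \<in> L \<Longrightarrow> hf x u = 0" and hv: "\<And>x. x \<in> L \<Longrightarrow> hf x v = 0"
  shows "mf u v = 0"
proof -
  let ?D = "\<lambda>w::real. dil (\<lambda>d. w ^ d)"
  define a where "a w = ip N (?D w u) (app T v)" for w
  define b where "b w = ip N (?D w u) (app Ts v)" for w
  define q where "q w = pf (?D w u) v" for w
  define f where "f w = complex_of_real (w + 1) * a w - 2 * q w" for w
  \<comment> \<open>At \<open>w = 1\<close> the two eigenvalue equations only determine the Hermitian part of \<open>mf u v\<close>. For
    \<open>w \<noteq> 1\<close> they give \<open>f w = 0\<close>, and continuity extends this to \<open>w = 1\<close>.\<close>
  have f0: "f w = 0" if w: "0 < w" "w \<noteq> 1" for w
  proof -
    let ?w = "complex_of_real w"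
    have "a w + b w = 2 * q w"
      using hv[OF dil_L[OF u, of "\<lambda>d. w ^ d"]] unfolding hf_def mf_def mf'_def a_def b_def q_def by (simp add: algebra_simps)
    moreover have "hf u (?D w v) = 0"
      using hu[OF dil_L[OF v]] fv.form_cnj[OF hermitian_form_hf, of u "?D w v"] by simp
    then have "?w * (?w * a w - q w + ip N u (app Ts (?D w v)) - q w) = 0"
      unfolding hf_def mf_def mf'_def dil_power_forms(1)[OF w(1)] pf_dil a_def q_def by (simp add: algebra_simps)
    then have "?w * ?w * a w + b w = 2 * ?w * q w"
      using dil_power_forms(2)[OF w(1), of u v] unfolding b_def by (simp add: algebra_simps)
    \<comment> \<open>Subtracting the equation for \<open>v\<close> from the one for
      \<open>u\<close> eliminates \<open>b w\<close> and leaves a common factor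
      \<open>w - 1\<close>.\<close>
    moreover have "(?w - 1) * f w = (?w * ?w * a w + b w - 2 * ?w * q w) - (a w + b w - 2 * q w)"
      unfolding f_def by (simp add: algebra_simps)
    ultimately have "(?w - 1) * f w = 0" by simp
    then show ?thesis using w(2) by simp
  qed
  have "isCont f 1"
    unfolding f_def a_def q_def pf_def ip_T[symmetric]
    unfolding ip_def dil_def by (intro continuous_intros)
  then have "(f \<longlongrightarrow> f 1) (at 1)" by (simp add: isCont_def)
  moreover have "(f \<longlongrightarrow> 0) (at 1)"
  proof (rule tendsto_eventually)
    show "\<forall>\<^sub>F w in at 1. f w = 0"
      unfolding eventually_at by (rule exI[of _ 1]) (auto intro!: f0 simp: dist_real_def)
  qed
  ultimately have "f 1 = 0" using tendsto_unique[OF at_neq_bot] by blast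
  \<comment> \<open>At \<open>w = 1\<close> the dilation is the identity and \<open>f 1\<close> is
    twice \<open>mf u v\<close>.\<close>
  moreover have "?D 1 u = u" by (simp add: dil_def)
  ultimately show ?thesis unfolding f_def a_def q_def mf_def by simp
qed

text \<open>The larger solution of \<open>z + 1 / z = nu + 2\<close>; the eigenvalue \<open>nu\<close> of \<open>H\<close> relative to \<open>T T*\<close> is \<open>\<mu> - 2\<close>.\<close>

definition twist_root :: "real \<Rightarrow> real" where
  "twist_root nu = (nu + 2 + sqrt ((nu + 2)\<^sup>2 - 4)) / 2"

lemma twist_root:
  assumes "0 \<le> nu"
  shows "1 \<le> twist_root nu" "twist_root nu + 1 / twist_root nu = nu + 2"
proof -
  define s where "s = sqrt ((nu + 2)\<^sup>2 - 4)"
  have "4 \<le> (nu + 2)\<^sup>2" using power_mono[of 2 "nu + 2" 2] assms by simp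
  then have s: "0 \<le> s" "s * s = (nu + 2)\<^sup>2 - 4" unfolding s_def by auto
  have r: "twist_root nu = (nu + 2 + s) / 2" unfolding twist_root_def s_def ..
  show 1: "1 \<le> twist_root nu" unfolding r using assms s by simp
  have "twist_root nu * twist_root nu + 1 = (nu + 2) * twist_root nu"
    unfolding r using s(2) by (simp add: field_simps power2_eq_square)
  then show "twist_root nu + 1 / twist_root nu = nu + 2" using 1 by (simp add: field_simps)
qed

text \<open>After reduction to \<open>L\<close>, the dimension is bounded by the number of relative
  eigenvectors with \<open>nu v \<ge> 0\<close>. Each of these is dilated to a twisted vector; the
  twisted vectors are independent and span, together with \<open>Ker\<close>, an
  \<open>mf\<close>-isotropic subspace.\<close>

lemma nonneg_imp_isotropic:
  assumes S: "fv.subspace S" "S \<subseteq> vecs N" "fv.nonneg_on hf S"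
  obtains R where "fv.subspace R" "R \<subseteq> vecs N" "\<And>x y. x \<in> R \<Longrightarrow> y \<in> R \<Longrightarrow> mf x y = 0"
    "fv.dim S \<le> fv.dim R"
proof -
  obtain S1 where S1: "fv.subspace S1" "S1 \<subseteq> L" "fv.nonneg_on hf S1" "fv.dim S \<le> fv.dim S1 + fv.dim Ker"
    using nonneg_reduce_to_L[OF S] .
  obtain B nu where B: "finite B" "fv.independent B" "fv.span B = L" "fv.orthonormal pf B"
    and ev: "\<And>x v. x \<in> L \<Longrightarrow> v \<in> B \<Longrightarrow> hf x v = complex_of_real (nu v) * pf x v"
    using fv.simultaneous_diagonalization[OF hermitian_form_hf hermitian_form_pf subspace_L finite_dim_L pos_def_pf_L]
    by metis
  define I where "I = {v\<in>B. 0 \<le> nu v}"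
  have ev': "\<And>x v. x \<in> fv.span B \<Longrightarrow> v \<in> B \<Longrightarrow> hf x v = complex_of_real (nu v) * pf x v"
    using ev B(3) by simp
  have card: "fv.dim S1 \<le> card I"
    unfolding I_def
    by (rule fv.nonneg_subspace_dim_le[OF hermitian_form_hf hermitian_form_pf B(1,4) ev' S1(1) _ S1(3)])
      (use S1(2) B(3) in auto)
  define z where "z v = twist_root (nu v)" for v
  define y where "y v = dil (\<lambda>d. z v ^ d) v" for v
  have I: "v \<in> B" "v \<in> L" "1 \<le> z v" "z v + 1 / z v = nu v + 2" if "v \<in> I" for v
    using that B(3) fv.span_base[of v B] twist_root[of "nu v"] unfolding I_def z_def by auto
  have finI: "finite I" using B(1) I_def by simp
  have tw: "twisted (z v) (y v)" if "v \<in> I" for v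
    unfolding y_def by (rule twisted_dil[OF _ ev]) (use I[OF that] in auto)
  have yL: "y v \<in> L" if "v \<in> I" for v using tw[OF that] unfolding twisted_def by blast
  have iso: "mf (y u) (y v) = 0" if uv: "u \<in> I" "v \<in> I" for u v
  proof (cases "z u * z v = 1")
    case False
    then show ?thesis by (intro twisted_isotropic[OF tw tw]) (use uv I in force)+
  next
    case True
    \<comment> \<open>Both roots are at least \<open>1\<close>, so a product equal to
      \<open>1\<close> forces both to be \<open>1\<close>. Then \<open>nu\<close> is zero and the
      dilation does nothing.\<close>
    have one: "z w = 1" if "z u * z v = 1" "w = u \<or> w = v" for w
      using that I(3)[OF uv(1)] I(3)[OF uv(2)]
      by (smt (verit) mult_le_cancel_left1 mult_le_cancel_right1)
    have null: "nu w = 0 \<and> y w = w" if "w = u \<or> w = v" for w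
      using one[OF True that] I(4)[of w] uv that by (auto simp: y_def dil_def)
    have "mf u v = 0" by (rule mf_null_pair) (use I uv ev null in auto)
    then show ?thesis using null by simp
  qed
  \<comment> \<open>The combination is grouped by root. Different roots separate by
    \<open>twisted_sum_eq_0\<close>; within one root all vectors are images under the same
    invertible dilation, so independence of the original basis applies.\<close>
  have indep: "c v = 0" if s: "(\<Sum>v\<in>I. fscale (c v) (y v)) = 0" and v: "v \<in> I" for c v
  proof -
    define e where "e \<zeta> = (\<Sum>w\<in>{w\<in>I. z w = \<zeta>}. fscale (c w) (y w))" for \<zeta>
    have "(\<Sum>\<zeta>\<in>z ` I. e \<zeta>) = 0"
      using s sum.image_gen[OF finI, of "\<lambda>v. fscale (c v) (y v)" z] unfolding e_def by simp
    then have "\<forall>\<zeta>\<in>z ` I. e \<zeta> = 0"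
    proof (rule twisted_sum_eq_0[rotated 3])
      show "0 < \<zeta>" if "\<zeta> \<in> z ` I" for \<zeta> using that I(3) by force
      show "twisted \<zeta> (e \<zeta>)" if "\<zeta> \<in> z ` I" for \<zeta>
        unfolding e_def by (rule twisted_sum) (use tw twisted_scale in auto)
    qed (use finI in simp)
    then have e0: "e (z v) = 0" using v by blast
    let ?J = "{w\<in>I. z w = z v}"
    define s where "s = (\<Sum>w\<in>?J. fscale (c w) w)"
    have "e (z v) = dil (\<lambda>d. z v ^ d) s"
      unfolding e_def s_def y_def dil_sum dil_scale by (rule sum.cong) auto
    moreover have "z v \<noteq> 0" using I(3)[OF v] by simp
    ultimately have "s = 0"
      using e0 by (auto simp: dil_def fun_eq_iff)
    moreover have "fv.independent ?J"
      using B(2) by (rule fv.independent_mono) (auto simp: I_def)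
    ultimately show "c v = 0"
      unfolding s_def using fv.independentD[of ?J ?J c v] finI v by auto
  qed
  \<comment> \<open>The linear map on \<open>span I\<close> sending each \<open>v\<close> to
    \<open>y v\<close>. Its injectivity yields the dimension of the image directly.\<close>
  define \<Psi> where "\<Psi> x = (\<Sum>v\<in>I. fscale (pf v x) (y v))" for x
  have \<Psi>_add: "\<Psi> (x + x') = \<Psi> x + \<Psi> x'" and \<Psi>_scale: "\<Psi> (fscale c x) = fscale c (\<Psi> x)" for x x' c
    unfolding \<Psi>_def by (simp_all add: fv.form_add_right[OF hermitian_form_pf]
      fv.form_scale_right[OF hermitian_form_pf] fv.scale_left_distrib sum.distrib fv.scale_sum_right)
  have lin: "Vector_Spaces.linear fscale fscale \<Psi>"
    unfolding Vector_Spaces.linear_def module_hom_def module_hom_axioms_def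
    using fv.vector_space_axioms fv.module_axioms by (simp add: \<Psi>_add \<Psi>_scale)
  have orthI: "fv.orthonormal pf I" using B(4) unfolding fv.orthonormal_def I_def by auto
  have inj: "inj_on \<Psi> (fv.span I)"
  proof (rule inj_onI)
    fix x x' assume x: "x \<in> fv.span I" "x' \<in> fv.span I" "\<Psi> x = \<Psi> x'"
    have "x' + (x - x') = x" by simp
    then have "\<Psi> x' + \<Psi> (x - x') = \<Psi> x" unfolding \<Psi>_add[symmetric] by simp
    then have "\<Psi> (x - x') = 0" using x(3) by simp
    then have "\<forall>v\<in>I. pf v (x - x') = 0"
      using indep[of "\<lambda>v. pf v (x - x')"] unfolding \<Psi>_def by blast
    moreover have "x - x' = (\<Sum>v\<in>I. fscale (pf v (x - x')) v)"
      by (rule fv.orthonormal_expansion[OF hermitian_form_pf finI orthI]) (use x fv.span_diff in blast)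
    ultimately have "x - x' = 0" by simp
    then show "x = x'" by simp
  qed
  let ?Y = "\<Psi> ` fv.span I"
  note im = fv.subspace_image_dim[OF fv.subspace_span fv.finite_dim_span[OF finI] lin inj]
  have indI: "fv.independent I" using B(2) by (rule fv.independent_mono) (auto simp: I_def)
  have dimY: "fv.dim ?Y = card I" using im(3) fv.dim_span_eq_card_independent[OF indI] by simp
  have Ysp: "?Y \<subseteq> fv.span (y ` I)"
    unfolding \<Psi>_def by (auto intro!: fv.span_sum fv.span_scale intro: fv.span_base)
  have YL: "?Y \<subseteq> L"
    using Ysp fv.span_minimal[of "y ` I" L] yL subspace_L by blast
  have isoY: "mf x x' = 0" if "x \<in> ?Y" "x' \<in> ?Y" for x x'
    unfolding mf_mat
    by (rule isotropic_span[of "y ` I"]) (use that Ysp iso in \<open>auto simp: mf_mat[symmetric]\<close>)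
  have mf_add_left: "mf (x + x') w = mf x w + mf x' w" for x x' w
    by (simp add: mf_mat ip_add_left)
  let ?R = "fv.span (Ker \<union> ?Y)"
  show ?thesis
  proof (rule that)
    show "fv.subspace ?R" by (rule fv.subspace_span)
    show "?R \<subseteq> vecs N"
      by (rule fv.span_minimal) (use Ker_vecs YL L_vecs subspace_vecs in auto)
    show "mf x x' = 0" if "x \<in> ?R" "x' \<in> ?R" for x x'
    proof -
      obtain k r where kr: "k \<in> Ker" "r \<in> ?Y" "x = k + r"
        using in_span_Un_subspaces[OF subspace_Ker im(1) \<open>x \<in> ?R\<close>] .
      obtain k' r' where kr': "k' \<in> Ker" "r' \<in> ?Y" "x' = k' + r'"
        using in_span_Un_subspaces[OF subspace_Ker im(1) \<open>x' \<in> ?R\<close>] .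
      \<comment> \<open>Of the four terms, those with \<open>k\<close> on the left vanish by
        \<open>mf_Ker_left\<close>. This one needs \<open>r \<in> L\<close>, and the last is
        isotropy of the twisted vectors.\<close>
      have "mf r k' = 0" using mf_L_Ker kr kr' YL by blast
      then show ?thesis
        unfolding kr(3) kr'(3) mf_add_left mf_add_right
        using mf_Ker_left[OF kr(1)] isoY[OF kr(2) kr'(2)] by simp
    qed
    have "fv.dim ?R = fv.dim Ker + fv.dim ?Y"
      by (rule dim_orthogonal_sum[of _ N]) (use subspace_Ker Ker_vecs im(1) YL L_vecs Ker_L_orthogonal in blast)+
    then show "fv.dim S \<le> fv.dim ?R" using dimY card S1(4) by simp
  qed
qed

lemma nonneg_dim_imp_isotropic_dim:
  assumes "nonneg_dim N (T + Ts - 2 \<cdot>\<^sub>m (T * Ts)) k"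
  shows "\<exists>j\<ge>k. isotropic_dim N (T - T * Ts) j"
proof -
  obtain S where S: "fv.subspace S" "S \<subseteq> vecs N" "fv.nonneg_on hf S" "fv.dim S = k"
    using assms unfolding nonneg_dim_def hf_mat[symmetric] by auto
  obtain R where "fv.subspace R" "R \<subseteq> vecs N" "\<And>x y. x \<in> R \<Longrightarrow> y \<in> R \<Longrightarrow> mf x y = 0"
    "fv.dim S \<le> fv.dim R"
    using nonneg_imp_isotropic[OF S(1-3)] by metis
  then show ?thesis
    using S(4) unfolding isotropic_dim_def mf_mat by blast
qed

end

section \<open>KMS matrices\<close>

lemma sum_blocks: "(\<Sum>r<m * n. f r) = (\<Sum>a<m. \<Sum>s<n. f (a * n + s :: nat))"
proof -
  have "(\<Sum>r<m * n. f r) = (\<Sum>a<m. sum f {a * n..<a * n + n})"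
    by (rule sum.nat_group[symmetric])
  also have "\<dots> = (\<Sum>a<m. \<Sum>s<n. f (a * n + s))"
  proof (rule sum.cong)
    fix a
    show "sum f {a * n..<a * n + n} = (\<Sum>s<n. f (a * n + s))"
      using sum.shift_bounds_nat_ivl[of f 0 "a * n" n] by (simp add: atLeast0LessThan add.commute)
  qed simp
  finally show ?thesis .
qed

lemma block_index_less: "(a::nat) < m \<Longrightarrow> s < n \<Longrightarrow> a * n + s < m * n"
  using mult_le_mono1[of "Suc a" m n] by simp

lemma block_div_mod [simp]: "s < n \<Longrightarrow> (a * n + s) div n = (a :: nat)" "s < n \<Longrightarrow> (a * n + s) mod n = s"
  by auto

lemma kron_dims [simp]: "dim_row (kron X Y) = dim_row X * dim_row Y" "dim_col (kron X Y) = dim_col X * dim_col Y"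
  by (simp_all add: kron_def)

lemma kron_carrier [simp]:
  "X \<in> carrier_mat a b \<Longrightarrow> Y \<in> carrier_mat c d \<Longrightarrow> kron X Y \<in> carrier_mat (a * c) (b * d)"
  by auto

lemma kron_index:
  "p < dim_row X * dim_row Y \<Longrightarrow> q < dim_col X * dim_col Y \<Longrightarrow>
    kron X Y $$ (p, q) = X $$ (p div dim_row Y, q div dim_col Y) * Y $$ (p mod dim_row Y, q mod dim_col Y)"
  by (simp add: kron_def)

text \<open>The inner summation index splits into block and position, and the resulting double sum
  is a product of two sums.\<close>

lemma kron_mult:
  assumes "X \<in> carrier_mat a b" "Y \<in> carrier_mat c d" "X' \<in> carrier_mat b e" "Y' \<in> carrier_mat d f"
  shows "kron X Y * kron X' Y' = kron (X * X') (Y * Y')"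
proof (rule eq_matI)
  fix p q assume "p < dim_row (kron (X * X') (Y * Y'))" "q < dim_col (kron (X * X') (Y * Y'))"
  then have pq: "p < a * c" "q < e * f" using assms by auto
  then have pos: "0 < c" "0 < f" by (auto intro: gr0I)
  have bnd: "p div c < a" "q div f < e" "p mod c < c" "q mod f < f"
    using pq pos by (auto simp: less_mult_imp_div_less)
  have "(kron X Y * kron X' Y') $$ (p, q) = (\<Sum>r<b * d. kron X Y $$ (p, r) * kron X' Y' $$ (r, q))"
    using pq assms by (simp add: scalar_prod_def atLeast0LessThan)
  also have "\<dots> = (\<Sum>k<b. \<Sum>s<d. kron X Y $$ (p, k * d + s) * kron X' Y' $$ (k * d + s, q))"
    by (rule sum_blocks)
  also have "\<dots> = (\<Sum>k<b. \<Sum>s<d. (X $$ (p div c, k) * X' $$ (k, q div f)) * (Y $$ (p mod c, s) * Y' $$ (s, q mod f)))"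
    by (intro sum.cong refl) (use pq assms in \<open>simp add: kron_index block_index_less\<close>)
  also have "\<dots> = (X * X') $$ (p div c, q div f) * (Y * Y') $$ (p mod c, q mod f)"
    using bnd assms by (simp add: scalar_prod_def atLeast0LessThan sum_product)
  also have "\<dots> = kron (X * X') (Y * Y') $$ (p, q)"
    using pq assms by (simp add: kron_index)
  finally show "(kron X Y * kron X' Y') $$ (p, q) = kron (X * X') (Y * Y') $$ (p, q)" .
qed (use assms in auto)

lemma kron_adjoint: "mat_adjoint (kron X Y) = kron (mat_adjoint X) (mat_adjoint Y)"
proof (rule eq_matI)
  fix p q assume "p < dim_row (kron (mat_adjoint X) (mat_adjoint Y))" "q < dim_col (kron (mat_adjoint X) (mat_adjoint Y))"
  then have pq: "p < dim_col X * dim_col Y" "q < dim_row X * dim_row Y" by auto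
  then have pos: "0 < dim_col Y" "0 < dim_row Y" by (auto intro: gr0I)
  have "p div dim_col Y < dim_col X" "q div dim_row Y < dim_row X" "p mod dim_col Y < dim_col Y" "q mod dim_row Y < dim_row Y"
    using pq pos by (auto simp: less_mult_imp_div_less)
  then show "mat_adjoint (kron X Y) $$ (p, q) = kron (mat_adjoint X) (mat_adjoint Y) $$ (p, q)"
    using pq by (simp add: kron_index)
qed auto

lemma jordan_block_index [simp]:
  "i < m \<Longrightarrow> j < m \<Longrightarrow> jordan_block m 0 $$ (i, j) = (if Suc i = j then 1 else (0::complex))"
  by (auto simp: jordan_block_def)

lemma diag_one_zero_index:
  assumes "0 < m" "i < m" "j < m"
  shows "diag_block_mat [1\<^sub>m (m - 1), 0\<^sub>m 1 1 :: complex mat] $$ (i, j) = (if i = j \<and> Suc i < m then 1 else 0)"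
  using assms by (auto simp: Let_def four_block_mat_def)

lemma diag_one_zero_carrier:
  "0 < m \<Longrightarrow> diag_block_mat [1\<^sub>m (m - 1), 0\<^sub>m 1 1 :: complex mat] \<in> carrier_mat m m"
  by (auto simp: Let_def)

text \<open>The last row of the Jordan block is zero and the others are distinct unit vectors. This
  is the source of the summand \<open>[0]\<close> in the first formula.\<close>

lemma jordan_block_mult_adjoint:
  assumes "0 < m"
  shows "jordan_block m 0 * mat_adjoint (jordan_block m 0) = diag_block_mat [1\<^sub>m (m - 1), 0\<^sub>m 1 1 :: complex mat]"
proof (rule eq_matI)
  let ?D = "diag_block_mat [1\<^sub>m (m - 1), 0\<^sub>m 1 1 :: complex mat]"
  fix i j assume "i < dim_row ?D" "j < dim_col ?D"
  then have ij: "i < m" "j < m" using diag_one_zero_carrier[OF assms] by (auto simp del: diag_block_mat.simps)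
  have "(jordan_block m 0 * mat_adjoint (jordan_block m 0)) $$ (i, j) =
      (\<Sum>k<m. (if Suc i = k then 1 else 0) * (if Suc j = k then 1 else (0::complex)))"
    using ij by (simp add: scalar_prod_def atLeast0LessThan) (rule sum.cong, auto)
  also have "\<dots> = (if i = j \<and> Suc i < m then 1 else 0)"
  proof -
    have "(\<Sum>k<m. (if Suc i = k then 1 else 0) * (if Suc j = k then 1 else (0::complex))) =
        (\<Sum>k<m. if k = Suc i then (if i = j then 1 else 0) else 0)"
      by (rule sum.cong) auto
    then show ?thesis by simp
  qed
  finally show "(jordan_block m 0 * mat_adjoint (jordan_block m 0)) $$ (i, j) = ?D $$ (i, j)"
    using diag_one_zero_index[OF assms ij] by simp
qed (use diag_one_zero_carrier[OF assms] in \<open>auto simp del: diag_block_mat.simps\<close>)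

section \<open>Congruence and real parts\<close>

lemma two_re_mat: "X \<in> carrier_mat N N \<Longrightarrow> 2 \<cdot>\<^sub>m re_mat X = X + mat_adjoint X"
  by (rule eq_matI) (auto simp: re_mat_def)

text \<open>The left inverse makes \<open>app C\<close> injective, so it carries the subspace to one
  of the same dimension. The reverse implication is obtained from the inverse congruence.\<close>

lemma nonneg_dim_congruence:
  assumes B: "B \<in> carrier_mat N N" and C: "C \<in> carrier_mat N N" and D: "D \<in> carrier_mat N N" "D * C = 1\<^sub>m N"
    and k: "nonneg_dim N (mat_adjoint C * B * C) k"
  shows "nonneg_dim N B k"
proof -
  have adj: "mat_adjoint C \<in> carrier_mat N N" using C by simp
  then have adjB: "mat_adjoint C * B \<in> carrier_mat N N" using B by (rule mult_carrier_mat)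
  have form: "ip N x (app (mat_adjoint C * B * C) y) = ip N (app C x) (app B (app C y))" for x y
    by (simp add: app_mult[OF adjB C] app_mult[OF adj B] ip_app_adjoint[OF adj])
  obtain S where S: "fv.subspace S" "S \<subseteq> vecs N" "fv.dim S = k"
    "fv.nonneg_on (\<lambda>x y. ip N (app C x) (app B (app C y))) S"
    using k unfolding nonneg_dim_def form by blast
  have "app D (app C x) = x" if "x \<in> S" for x
    using app_mult[OF D(1) C, of x] D(2) app_one[of x N] that S(2) by auto
  then have inj: "inj_on (app C) S" by (metis inj_onI)
  note im = fv.subspace_image_dim[OF S(1) fv.finite_dim_subset[OF finite_dim_vecs S(2)] linear_app inj]
  show ?thesis
    unfolding nonneg_dim_def
    by (rule exI[of _ "app C ` S"]) (use im S C in \<open>auto simp: fv.nonneg_on_def\<close>)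
qed

lemma isotropic_dim_congruence:
  assumes B: "B \<in> carrier_mat N N" and C: "C \<in> carrier_mat N N" and D: "D \<in> carrier_mat N N" "D * C = 1\<^sub>m N"
    and k: "isotropic_dim N (mat_adjoint C * B * C) k"
  shows "isotropic_dim N B k"
proof -
  have adj: "mat_adjoint C \<in> carrier_mat N N" using C by simp
  then have adjB: "mat_adjoint C * B \<in> carrier_mat N N" using B by (rule mult_carrier_mat)
  have form: "ip N x (app (mat_adjoint C * B * C) y) = ip N (app C x) (app B (app C y))" for x y
    by (simp add: app_mult[OF adjB C] app_mult[OF adj B] ip_app_adjoint[OF adj])
  obtain S where S: "fv.subspace S" "S \<subseteq> vecs N" "fv.dim S = k"
    "\<forall>x\<in>S. \<forall>y\<in>S. ip N (app C x) (app B (app C y)) = 0"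
    using k unfolding isotropic_dim_def form by blast
  have "app D (app C x) = x" if "x \<in> S" for x
    using app_mult[OF D(1) C, of x] D(2) app_one[of x N] that S(2) by auto
  then have inj: "inj_on (app C) S" by (metis inj_onI)
  note im = fv.subspace_image_dim[OF S(1) fv.finite_dim_subset[OF finite_dim_vecs S(2)] linear_app inj]
  show ?thesis
    unfolding isotropic_dim_def
    by (rule exI[of _ "app C ` S"]) (use im S C in auto)
qed

lemma re_mat_carrier [simp]: "X \<in> carrier_mat N N \<Longrightarrow> re_mat X \<in> carrier_mat N N"
  by (simp add: re_mat_def)

lemma re_mat_adjoint: "X \<in> carrier_mat N N \<Longrightarrow> mat_adjoint (re_mat X) = re_mat X"
  by (rule eq_matI) (auto simp: re_mat_def)

lemma nonneg_dim_smult: "0 < c \<Longrightarrow> nonneg_dim N (complex_of_real c \<cdot>\<^sub>m B) k \<longleftrightarrow> nonneg_dim N B k"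
  unfolding nonneg_dim_def fv.nonneg_on_def
  by (simp add: app_smult ip_scale_right zero_le_mult_iff)

text \<open>On an isotropic subspace the form of the real part vanishes, so the same subspace
  serves. This gives the easy inequality between the two indices.\<close>

lemma isotropic_dim_imp_nonneg_dim_re:
  assumes X: "X \<in> carrier_mat N N" and k: "isotropic_dim N X k"
  shows "nonneg_dim N (re_mat X) k"
proof -
  obtain S where S: "fv.subspace S" "S \<subseteq> vecs N" "\<forall>x\<in>S. \<forall>y\<in>S. ip N x (app X y) = 0" "fv.dim S = k"
    using k unfolding isotropic_dim_def by blast
  have "ip N x (app (re_mat X) x) = 0" if "x \<in> S" for x
  proof -
    have "ip N x (app (mat_adjoint X) x) = cnj (ip N x (app X x))"
      using ip_app_adjoint[of "mat_adjoint X" N N x x] X ip_cnj[of N "app X x" x] by simp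
    then show ?thesis
      using S(3) that X
      by (simp add: re_mat_def app_smult app_plus[of X N N] ip_scale_right ip_add_right)
  qed
  then show ?thesis
    unfolding nonneg_dim_def fv.nonneg_on_def using S by (intro exI[of _ S]) simp
qed

section \<open>The resolvent identity for the KMS matrix and the first formula\<close>

lemma pow_mat_Suc_left: "A \<in> carrier_mat n n \<Longrightarrow> A ^\<^sub>m Suc k = A * A ^\<^sub>m k"
proof (induction k)
  case (Suc k)
  have "A ^\<^sub>m Suc (Suc k) = (A * A ^\<^sub>m k) * A" using Suc by simp
  also have "\<dots> = A * (A ^\<^sub>m k * A)"
    by (rule assoc_mult_mat[of _ n n _ n _ n]) (use Suc.prems in auto)
  finally show ?case by simp
qed simp

lemma kms_carrier: "A \<in> carrier_mat n n \<Longrightarrow> kms m A \<in> carrier_mat (m * n) (m * n)"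
  by (simp add: kms_def Let_def)

lemma kms_index:
  "A \<in> carrier_mat n n \<Longrightarrow> p < m * n \<Longrightarrow> q < m * n \<Longrightarrow> kms m A $$ (p, q) =
    (if p div n < q div n then (A ^\<^sub>m (q div n - p div n)) $$ (p mod n, q mod n) else 0)"
  by (simp add: kms_def Let_def)

lemma kron_jordan_graded:
  assumes "A \<in> carrier_mat n n" "i < m * n" "j < m * n" "kron (jordan_block m 0) A $$ (i, j) \<noteq> 0"
  shows "j div n = i div n + 1"
proof -
  have "i div n < m" "j div n < m" using assms by (auto simp: less_mult_imp_div_less)
  then show ?thesis using assms by (auto simp: kron_index split: if_splits)
qed

text \<open>\<open>kms m A\<close> is the sum of the positive powers of the nilpotent matrix \<open>J\<^sub>m(0) \<otimes> A\<close>.\<close>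

lemma kms_resolvent:
  fixes m :: nat
  assumes A: "A \<in> carrier_mat n n"
  defines "T \<equiv> kron (jordan_block m 0) A"
  shows "kms m A = T + T * kms m A"
proof (rule eq_matI)
  have T: "T \<in> carrier_mat (m * n) (m * n)" unfolding T_def using A by simp
  note K = kms_carrier[OF A, of m]
  show "dim_row (kms m A) = dim_row (T + T * kms m A)" "dim_col (kms m A) = dim_col (T + T * kms m A)"
    using T K by auto
  fix p q assume "p < dim_row (T + T * kms m A)" "q < dim_col (T + T * kms m A)"
  then have pq: "p < m * n" "q < m * n" using T K by auto
  define a s b t where "a = p div n" "s = p mod n" "b = q div n" "t = q mod n"
  have bnd: "a < m" "b < m" "s < n" "t < n"
    unfolding a_s_b_t_def using pq by (auto simp: less_mult_imp_div_less intro!: mod_less_divisor intro: gr0I)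
  have Tidx: "T $$ (p, k * n + r) = (if Suc a = k then A $$ (s, r) else 0)" if "k < m" "r < n" for k r
    using pq that A bnd block_index_less[OF that] unfolding T_def a_s_b_t_def by (simp add: kron_index)
  have Kidx: "kms m A $$ (k * n + r, q) = (if k < b then (A ^\<^sub>m (b - k)) $$ (r, t) else 0)" if "k < m" "r < n" for k r
    using pq that A block_index_less[OF that] unfolding a_s_b_t_def by (simp add: kms_index)
  have "(T * kms m A) $$ (p, q) = (\<Sum>r<m * n. T $$ (p, r) * kms m A $$ (r, q))"
    using pq T K by (simp add: scalar_prod_def atLeast0LessThan)
  also have "\<dots> = (\<Sum>k<m. \<Sum>r<n. T $$ (p, k * n + r) * kms m A $$ (k * n + r, q))"
    by (rule sum_blocks)
  \<comment> \<open>Block row \<open>a\<close> of \<open>T\<close> is nonzero only in block column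
    \<open>Suc a\<close>; for the last block row it is entirely zero.\<close>
  also have "\<dots> = (\<Sum>k<m. if k = Suc a then \<Sum>r<n. A $$ (s, r) * (if Suc a < b then (A ^\<^sub>m (b - Suc a)) $$ (r, t) else 0) else 0)"
    by (intro sum.cong refl) (auto simp: Tidx Kidx)
  also have "\<dots> = (if Suc a < m then \<Sum>r<n. A $$ (s, r) * (if Suc a < b then (A ^\<^sub>m (b - Suc a)) $$ (r, t) else 0) else 0)"
    by simp
  also have "\<dots> = (if Suc a < b then (A * A ^\<^sub>m (b - Suc a)) $$ (s, t) else 0)"
    using bnd A by (simp add: scalar_prod_def atLeast0LessThan)
  finally have TK: "(T * kms m A) $$ (p, q) = (if Suc a < b then (A * A ^\<^sub>m (b - Suc a)) $$ (s, t) else 0)" .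
  have "T $$ (p, q) = (if Suc a = b then A $$ (s, t) else 0)"
    using pq A bnd unfolding T_def a_s_b_t_def by (simp add: kron_index)
  moreover have "kms m A $$ (p, q) = (if a < b then (A ^\<^sub>m (b - a)) $$ (s, t) else 0)"
    using pq A unfolding a_s_b_t_def by (simp add: kms_index)
  \<comment> \<open>Blocks with \<open>b = Suc a\<close> come from \<open>T\<close> alone and those
    farther to the right from the product, where one factor \<open>A\<close> is split off on the
    left.\<close>
  moreover have "A ^\<^sub>m (b - a) = A * A ^\<^sub>m (b - Suc a)" if "Suc a < b"
    using that pow_mat_Suc_left[OF A, of "b - Suc a"] by (simp add: Suc_diff_Suc del: pow_mat.simps)
  moreover have "(T + T * kms m A) $$ (p, q) = T $$ (p, q) + (T * kms m A) $$ (p, q)"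
    using pq T K by simp
  ultimately show "kms m A $$ (p, q) = (T + T * kms m A) $$ (p, q)"
    unfolding TK using A by (cases "b = Suc a") auto
qed

lemma num_nonneg_eigenvalues_cong:
  assumes A: "A \<in> carrier_mat N N" "mat_adjoint A = A" and B: "B \<in> carrier_mat N N" "mat_adjoint B = B"
    and iff: "\<And>k. nonneg_dim N A k \<longleftrightarrow> nonneg_dim N B k"
  shows "num_nonneg_eigenvalues A = num_nonneg_eigenvalues B"
  using num_nonneg_eigenvalues_nonneg_dim[OF A] num_nonneg_eigenvalues_nonneg_dim[OF B] iff
  by (meson le_antisym)

lemma two_re_minus_adjoint:
  assumes X: "X \<in> carrier_mat N N" and Y: "Y \<in> carrier_mat N N" "mat_adjoint Y = Y"
  shows "mat_adjoint (2 \<cdot>\<^sub>m re_mat X - 2 \<cdot>\<^sub>m Y) = 2 \<cdot>\<^sub>m re_mat X - 2 \<cdot>\<^sub>m Y"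
proof -
  have "mat_adjoint (2 \<cdot>\<^sub>m re_mat X - 2 \<cdot>\<^sub>m Y) = mat_adjoint (2 \<cdot>\<^sub>m re_mat X) - mat_adjoint (2 \<cdot>\<^sub>m Y)"
    by (rule mat_adjoint_minus[of _ N N]) (use X Y in auto)
  then show ?thesis by (simp add: mat_adjoint_smult re_mat_adjoint[OF X] Y(2))
qed

lemma mult_adjoint_hermitian:
  "X \<in> carrier_mat n m \<Longrightarrow> mat_adjoint (X * mat_adjoint X) = X * mat_adjoint (X :: complex mat)"
  by (subst mat_adjoint_mult[of _ n m _ n]) auto

lemma kms_hermitian_form_matrix:
  assumes A: "A \<in> carrier_mat n n" and m: "0 < m"
  defines "T \<equiv> kron (jordan_block m 0) A"
  shows "2 \<cdot>\<^sub>m re_mat T - 2 \<cdot>\<^sub>m kron (diag_block_mat [1\<^sub>m (m - 1), 0\<^sub>m 1 1]) (A * mat_adjoint A) =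
    T + mat_adjoint T - 2 \<cdot>\<^sub>m (T * mat_adjoint T)"
proof -
  have J: "jordan_block m 0 \<in> carrier_mat m m" by simp
  have T: "T \<in> carrier_mat (m * n) (m * n)" unfolding T_def using A by simp
  have "T * mat_adjoint T = kron (diag_block_mat [1\<^sub>m (m - 1), 0\<^sub>m 1 1]) (A * mat_adjoint A)"
    unfolding T_def kron_adjoint jordan_block_mult_adjoint[OF m, symmetric]
    by (rule kron_mult[of _ m m _ n n _ m _ n]) (use A in auto)
  then show ?thesis using two_re_mat[OF T] by simp
qed

text \<open>Put \<open>P = 1 - T\<close> and \<open>Q = 1 + K\<close>. The resolvent identity gives
  \<open>P * Q = 1\<close> and \<open>P * K = T\<close>. With \<open>C\<close> the adjoint of
  \<open>P\<close>, the congruence takes \<open>K\<close> to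
  \<open>T * C = T - T * mat_adjoint T\<close>, and the second identity adds the adjoint of the
  first.\<close>

lemma kms_congruence:
  fixes m :: nat
  assumes A: "A \<in> carrier_mat n n"
  defines "N \<equiv> m * n" and "T \<equiv> kron (jordan_block m 0) A" and "K \<equiv> kms m A"
  obtains C D where "C \<in> carrier_mat N N" "D \<in> carrier_mat N N" "C * D = 1\<^sub>m N" "D * C = 1\<^sub>m N"
    "mat_adjoint C * K * C = T - T * mat_adjoint T"
    "mat_adjoint C * (K + mat_adjoint K) * C = T + mat_adjoint T - 2 \<cdot>\<^sub>m (T * mat_adjoint T)"
proof -
  have T: "T \<in> carrier_mat N N" unfolding T_def N_def using A by simp
  have K: "K \<in> carrier_mat N N" unfolding K_def N_def by (rule kms_carrier[OF A])
  have one: "1\<^sub>m N \<in> carrier_mat N N" by simp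
  have TK: "T * K \<in> carrier_mat N N" using T K by (rule mult_carrier_mat)
  have res: "K = T + T * K" unfolding K_def T_def by (rule kms_resolvent[OF A])
  define P where "P = 1\<^sub>m N - T"
  define Q where "Q = 1\<^sub>m N + K"
  have P: "P \<in> carrier_mat N N" and Q: "Q \<in> carrier_mat N N"
    unfolding P_def Q_def using T K by auto
  have PX: "P * X = X - T * X" if "X \<in> carrier_mat N N" for X
    unfolding P_def using minus_mult_distrib_mat[OF one T that] that by simp
  have "T * Q = T + T * K"
    unfolding Q_def using mult_add_distrib_mat[OF T one K] T by simp
  then have "P * Q = Q - K" using PX[OF Q] res by simp
  also have "\<dots> = 1\<^sub>m N" unfolding Q_def using K by (intro eq_matI) auto
  finally have PQ: "P * Q = 1\<^sub>m N" .
  have QP: "Q * P = 1\<^sub>m N" by (rule mat_mult_left_right_inverse[OF P Q PQ])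
  have "P * K = (T + T * K) - T * K" using PX[OF K] res by simp
  also have "\<dots> = T" using T TK by (intro eq_matI) auto
  finally have PK: "P * K = T" .
  define C where "C = mat_adjoint P"
  define D where "D = mat_adjoint Q"
  have C: "C \<in> carrier_mat N N" and D: "D \<in> carrier_mat N N" unfolding C_def D_def using P Q by auto
  have Ts: "mat_adjoint T \<in> carrier_mat N N" and Ks: "mat_adjoint K \<in> carrier_mat N N" using T K by auto
  have TTs: "T * mat_adjoint T \<in> carrier_mat N N" using T Ts by (rule mult_carrier_mat)
  have Cadj: "mat_adjoint C = P" unfolding C_def by simp
  have C': "C = 1\<^sub>m N - mat_adjoint T"
    unfolding C_def P_def by (subst mat_adjoint_minus[OF one T]) (simp add: mat_adjoint_one)
  have TC: "T * C = T - T * mat_adjoint T"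
    unfolding C' using mult_minus_distrib_mat[OF T one Ts] T by simp
  have KsC: "mat_adjoint K * C = mat_adjoint T"
    unfolding C_def mat_adjoint_mult[OF P K, symmetric] PK ..
  have PKsC: "P * mat_adjoint K * C = mat_adjoint T - T * mat_adjoint T"
    using assoc_mult_mat[OF P Ks C] KsC PX[OF Ts] by simp
  show ?thesis
  proof (rule that[OF C D])
    show "C * D = 1\<^sub>m N" unfolding C_def D_def mat_adjoint_mult[OF Q P, symmetric] QP by (rule mat_adjoint_one)
    show "D * C = 1\<^sub>m N" unfolding C_def D_def mat_adjoint_mult[OF P Q, symmetric] PQ by (rule mat_adjoint_one)
    show "mat_adjoint C * K * C = T - T * mat_adjoint T" unfolding Cadj PK by (rule TC)
    have PKs: "P * mat_adjoint K \<in> carrier_mat N N" using P Ks by (rule mult_carrier_mat)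
    have "mat_adjoint C * (K + mat_adjoint K) * C = T * C + P * mat_adjoint K * C"
      unfolding Cadj mult_add_distrib_mat[OF P K Ks] PK by (rule add_mult_distrib_mat[OF T PKs C])
    also have "\<dots> = T + mat_adjoint T - 2 \<cdot>\<^sub>m (T * mat_adjoint T)"
      unfolding TC PKsC using T Ts TTs by (intro eq_matI) auto
    finally show "mat_adjoint C * (K + mat_adjoint K) * C = T + mat_adjoint T - 2 \<cdot>\<^sub>m (T * mat_adjoint T)" .
  qed
qed

text \<open>An isotropic subspace of \<open>K\<close> is nonnegative for its real part. Conversely,
  congruence moves a nonnegative subspace to \<open>H\<close>, the graded argument turns it into an
  isotropic subspace of \<open>T - T * mat_adjoint T\<close> of at least the same dimension, and
  congruence brings that back to \<open>K\<close>.\<close>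

lemma zero_dilation_index_kms:
  assumes A: "A \<in> carrier_mat n n" and m: "0 < m"
  defines "H \<equiv> 2 \<cdot>\<^sub>m re_mat (kron (jordan_block m 0) A)
     - 2 \<cdot>\<^sub>m kron (diag_block_mat [1\<^sub>m (m - 1), 0\<^sub>m 1 1]) (A * mat_adjoint A)"
  shows "zero_dilation_index (kms m A) = num_nonneg_eigenvalues (re_mat (kms m A))"
    and "num_nonneg_eigenvalues (re_mat (kms m A)) = num_nonneg_eigenvalues H"
    and "H \<in> carrier_mat (m * n) (m * n)" and "mat_adjoint H = H"
proof -
  define N where "N = m * n"
  define T where "T = kron (jordan_block m 0) A"
  define K where "K = kms m A"
  have T: "T \<in> carrier_mat N N" unfolding T_def N_def using A by simp
  have K: "K \<in> carrier_mat N N" unfolding K_def N_def by (rule kms_carrier[OF A])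
  have DD: "kron (diag_block_mat [1\<^sub>m (m - 1), 0\<^sub>m 1 1]) (A * mat_adjoint A) = T * mat_adjoint T"
    unfolding T_def kron_adjoint jordan_block_mult_adjoint[OF m, symmetric]
    by (rule kron_mult[of _ m m _ n n _ m _ n, symmetric]) (use A in auto)
  have Ts: "mat_adjoint T \<in> carrier_mat N N" using T by simp
  have TTs: "T * mat_adjoint T \<in> carrier_mat N N" using T Ts by (rule mult_carrier_mat)
  have HT: "H = 2 \<cdot>\<^sub>m re_mat T - 2 \<cdot>\<^sub>m (T * mat_adjoint T)" unfolding H_def DD T_def ..
  have H: "H \<in> carrier_mat N N" unfolding HT by (intro minus_carrier_mat smult_carrier_mat TTs)
  show "H \<in> carrier_mat (m * n) (m * n)" using H unfolding N_def .
  show Hh: "mat_adjoint H = H"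
    unfolding HT by (rule two_re_minus_adjoint[OF T TTs mult_adjoint_hermitian[OF T]])
  have Heq: "H = T + mat_adjoint T - 2 \<cdot>\<^sub>m (T * mat_adjoint T)"
    unfolding HT two_re_mat[OF T] ..
  have B: "K + mat_adjoint K \<in> carrier_mat N N" using K by simp
  obtain C D where C: "C \<in> carrier_mat N N" and D: "D \<in> carrier_mat N N"
    and CD: "C * D = 1\<^sub>m N" and DC: "D * C = 1\<^sub>m N"
    and M: "mat_adjoint C * K * C = T - T * mat_adjoint T"
    and CH: "mat_adjoint C * (K + mat_adjoint K) * C = H"
    unfolding Heq using kms_congruence[OF A, of m] unfolding N_def T_def K_def by metis
  have Cs: "mat_adjoint C \<in> carrier_mat N N" and Ds: "mat_adjoint D \<in> carrier_mat N N" using C D by auto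
  \<comment> \<open>The congruence is undone by \<open>D\<close>, so that nonnegative dimensions
    transfer in both directions.\<close>
  have inv_congr: "mat_adjoint D * H * D = K + mat_adjoint K"
  proof -
    let ?B = "K + mat_adjoint K"
    have BC: "?B * C \<in> carrier_mat N N" using B C by (rule mult_carrier_mat)
    have "mat_adjoint D * H = mat_adjoint D * (mat_adjoint C * (?B * C))"
      unfolding CH[symmetric] using assoc_mult_mat[OF Cs B C] by simp
    also have "\<dots> = (mat_adjoint D * mat_adjoint C) * (?B * C)"
      by (rule assoc_mult_mat[OF Ds Cs BC, symmetric])
    also have "mat_adjoint D * mat_adjoint C = 1\<^sub>m N"
      unfolding mat_adjoint_mult[OF C D, symmetric] CD by (rule mat_adjoint_one)
    finally have "mat_adjoint D * H = ?B * C" unfolding left_mult_one_mat[OF BC] .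
    then have "mat_adjoint D * H * D = ?B * (C * D)" using assoc_mult_mat[OF B C D] by simp
    then show ?thesis unfolding CD right_mult_one_mat[OF B] .
  qed
  have iff: "nonneg_dim N (re_mat K) k \<longleftrightarrow> nonneg_dim N H k" for k
  proof -
    have "nonneg_dim N (re_mat K) k \<longleftrightarrow> nonneg_dim N (K + mat_adjoint K) k"
      using nonneg_dim_smult[of 2 N "re_mat K" k] two_re_mat[OF K] by simp
    also have "\<dots> \<longleftrightarrow> nonneg_dim N H k"
      using nonneg_dim_congruence[OF B C D DC, of k] nonneg_dim_congruence[OF H D C CD, of k]
      unfolding CH inv_congr by blast
    finally show ?thesis .
  qed
  have R: "re_mat K \<in> carrier_mat N N" "mat_adjoint (re_mat K) = re_mat K"
    using K by (simp_all add: re_mat_adjoint[OF K])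
  show "num_nonneg_eigenvalues (re_mat (kms m A)) = num_nonneg_eigenvalues H"
    using num_nonneg_eigenvalues_cong[OF R H Hh iff] unfolding K_def .
  \<comment> \<open>The degree of a coordinate is its block index.\<close>
  interpret graded_matrix N T "\<lambda>i. i div n"
  proof
    show "T \<in> carrier_mat N N" by (rule T)
    show "j div n = i div n + 1" if "i < N" "j < N" "T $$ (i, j) \<noteq> 0" for i j
      using kron_jordan_graded[OF A, of i m j] that unfolding N_def T_def by blast
  qed
  show "zero_dilation_index (kms m A) = num_nonneg_eigenvalues (re_mat (kms m A))"
    unfolding K_def[symmetric]
  proof (rule le_antisym)
    show "zero_dilation_index K \<le> num_nonneg_eigenvalues (re_mat K)"
      by (intro num_nonneg_eigenvalues_nonneg_dim(2)[OF R] isotropic_dim_imp_nonneg_dim_re[OF K]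
          zero_dilation_index_isotropic_dim(1)[OF K])
    have "nonneg_dim N H (num_nonneg_eigenvalues (re_mat K))"
      using num_nonneg_eigenvalues_nonneg_dim(1)[OF R] iff by blast
    then obtain j where j: "num_nonneg_eigenvalues (re_mat K) \<le> j" "isotropic_dim N (T - T * mat_adjoint T) j"
      using nonneg_dim_imp_isotropic_dim unfolding Heq by blast
    have "isotropic_dim N K j"
      by (rule isotropic_dim_congruence[OF K C D DC]) (use j(2) M in simp)
    then show "num_nonneg_eigenvalues (re_mat K) \<le> zero_dilation_index K"
      using zero_dilation_index_isotropic_dim(2)[OF K] j(1) le_trans by blast
  qed
qed

section \<open>The nonsingular case: trailing and leading blocks\<close>

lemma dim_vecs_tail:
  assumes "a \<le> N"
  shows "fv.dim {x \<in> vecs N. \<forall>i<a. x i = 0} = N - a"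
proof -
  let ?R = "{x \<in> vecs N. \<forall>i<a. x i = 0}"
  have sub: "fv.subspace ?R"
    using subspace_vecs[of N] by (auto intro!: fv.subspaceI simp: vecs_def)
  have vv: "vecs a \<subseteq> vecs N" using assms by (auto simp: vecs_def)
  have "fv.dim (fv.span (vecs a \<union> ?R)) = fv.dim (vecs a) + fv.dim ?R"
  proof (rule dim_orthogonal_sum[OF subspace_vecs vv sub])
    show "ip N x y = 0" if "x \<in> vecs a" "y \<in> ?R" for x y
      unfolding ip_def using that by (intro sum.neutral) (auto simp: vecs_def not_less[symmetric])
  qed auto
  moreover have "fv.span (vecs a \<union> ?R) = vecs N"
  proof
    show "fv.span (vecs a \<union> ?R) \<subseteq> vecs N"
      by (rule fv.span_minimal) (use vv subspace_vecs in auto)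
    show "vecs N \<subseteq> fv.span (vecs a \<union> ?R)"
    proof
      fix x assume x: "x \<in> vecs N"
      let ?y = "\<lambda>i. if i < a then x i else 0" and ?z = "\<lambda>i. if i < a then 0 else x i"
      have "?y \<in> fv.span (vecs a \<union> ?R)" "?z \<in> fv.span (vecs a \<union> ?R)"
        using x by (auto intro!: fv.span_base simp: vecs_def)
      then have "?y + ?z \<in> fv.span (vecs a \<union> ?R)" by (rule fv.span_add)
      also have "?y + ?z = x" by (rule ext) simp
      finally show "x \<in> fv.span (vecs a \<union> ?R)" .
    qed
  qed
  ultimately show ?thesis by (simp add: dim_vecs)
qed

lemma ip_leading_block:
  assumes H: "H \<in> carrier_mat N N" and H': "H' \<in> carrier_mat N' N'" and le: "N' \<le> N"
    and eq: "\<And>i j. i < N' \<Longrightarrow> j < N' \<Longrightarrow> H $$ (i, j) = H' $$ (i, j)"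
    and x: "x \<in> vecs N'" and y: "y \<in> vecs N'"
  shows "ip N x (app H y) = ip N' x (app H' y)"
proof -
  have "ip N x (app H y) = (\<Sum>i<N'. cnj (x i) * app H y i)"
    unfolding ip_def by (rule sum.mono_neutral_right) (use x le in \<open>auto simp: vecs_def\<close>)
  also have "\<dots> = (\<Sum>i<N'. cnj (x i) * app H' y i)"
  proof (rule sum.cong)
    fix i assume i: "i \<in> {..<N'}"
    have "(\<Sum>j<N. H $$ (i, j) * y j) = (\<Sum>j<N'. H $$ (i, j) * y j)"
      by (rule sum.mono_neutral_right) (use y le in \<open>auto simp: vecs_def\<close>)
    also have "\<dots> = (\<Sum>j<N'. H' $$ (i, j) * y j)" by (rule sum.cong) (use eq i in auto)
    finally show "cnj (x i) * app H y i = cnj (x i) * app H' y i"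
      using i le H H' by (simp add: app_def)
  qed simp
  finally show ?thesis by (simp add: ip_def)
qed

text \<open>For nonsingular \<open>A\<close>, \<open>Ker\<close> is the last block and has dimension
  \<open>n\<close>, and \<open>L\<close> is the span of the first \<open>m - 2\<close> blocks, where
  the form of \<open>H\<close> is that of \<open>H'\<close>. The reduction to \<open>L\<close> and
  its converse then give both inequalities.\<close>

lemma num_nonneg_eigenvalues_kms_invertible:
  assumes A: "A \<in> carrier_mat n n" and inv: "invertible_mat A" and m: "2 \<le> m"
  defines "H \<equiv> 2 \<cdot>\<^sub>m re_mat (kron (jordan_block m 0) A)
     - 2 \<cdot>\<^sub>m kron (diag_block_mat [1\<^sub>m (m - 1), 0\<^sub>m 1 1]) (A * mat_adjoint A)"
    and "H' \<equiv> 2 \<cdot>\<^sub>m re_mat (kron (jordan_block (m - 2) 0) A) - 2 \<cdot>\<^sub>m kron (1\<^sub>m (m - 2)) (A * mat_adjoint A)"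
  shows "num_nonneg_eigenvalues H = n + num_nonneg_eigenvalues H'"
proof -
  define N where "N = m * n"
  define N' where "N' = (m - 2) * n"
  define T where "T = kron (jordan_block m 0) A"
  have m0: "0 < m" using m by simp
  have H: "H \<in> carrier_mat N N" "mat_adjoint H = H"
    unfolding H_def N_def using zero_dilation_index_kms(3,4)[OF A m0] by auto
  have AA: "A * mat_adjoint A \<in> carrier_mat n n" using A by (intro mult_carrier_mat) auto
  have H': "H' \<in> carrier_mat N' N'" unfolding H'_def N'_def by (intro minus_carrier_mat smult_carrier_mat kron_carrier AA one_carrier_mat)
  have Hh': "mat_adjoint H' = H'"
    unfolding H'_def
    by (rule two_re_minus_adjoint[of _ N']) (use A AA in \<open>simp_all add: N'_def kron_adjoint mat_adjoint_one mult_adjoint_hermitian[OF A]\<close>)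
  have T: "T \<in> carrier_mat N N" unfolding T_def N_def using A by simp
  have Heq: "H = T + mat_adjoint T - 2 \<cdot>\<^sub>m (T * mat_adjoint T)"
    unfolding H_def T_def by (rule kms_hermitian_form_matrix[OF A m0])
  have le: "N' \<le> (m - 1) * n" "(m - 1) * n \<le> N" "N' \<le> N" unfolding N_def N'_def by (auto intro!: mult_le_mono1)
  interpret graded_matrix N T "\<lambda>i. i div n"
  proof
    show "T \<in> carrier_mat N N" by (rule T)
    show "j div n = i div n + 1" if "i < N" "j < N" "T $$ (i, j) \<noteq> 0" for i j
      using kron_jordan_graded[OF A, of i m j] that unfolding N_def T_def by blast
  qed
  \<comment> \<open>On the first \<open>m - 2\<close> blocks the Jordan block of size
    \<open>m\<close> agrees with the smaller one and the diagonal factor is the identity.\<close>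
  have entries: "H $$ (i, j) = H' $$ (i, j)" if ij: "i < N'" "j < N'" for i j
  proof -
    have b: "i div n < m - 2" "j div n < m - 2" using ij unfolding N'_def by (auto simp: less_mult_imp_div_less)
    have b': "i < m * n" "j < m * n" using ij le(3) unfolding N_def by auto
    have D: "diag_block_mat [1\<^sub>m (m - 1), 0\<^sub>m 1 1 :: complex mat] $$ (i div n, j div n) = 1\<^sub>m (m - 2) $$ (i div n, j div n)"
      using b by (subst diag_one_zero_index[OF m0]) auto
    note Dc = carrier_matD[OF diag_one_zero_carrier[OF m0]]
    show ?thesis
      unfolding H_def H'_def
      using ij b b' A D Dc unfolding N'_def
      by (simp add: two_re_mat[of _ "m * n"] two_re_mat[of _ "(m - 2) * n"] kron_index del: diag_block_mat.simps)
  qed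
  obtain A' where A': "A' \<in> carrier_mat n n" "A * A' = 1\<^sub>m n"
    using inv A unfolding invertible_mat_def inverts_mat_def
    by (metis carrier_matD carrier_matI index_mult_mat(2,3) index_one_mat(2,3))
  \<comment> \<open>With zero-based blocks, block \<open>Suc a\<close> of \<open>app Ts x\<close> is
    the adjoint of \<open>A\<close> applied to block \<open>a\<close> of \<open>x\<close>, and this
    adjoint is injective.\<close>
  have block: "x (a * n + s) = 0"
    if a: "Suc a < m" and z: "\<And>t. t < n \<Longrightarrow> app Ts x (Suc a * n + t) = 0" and s: "s < n" for a s x
  proof -
    define w where "w s = (if s < n then x (a * n + s) else 0)" for s
    have w: "w \<in> vecs n" by (simp add: w_def vecs_def)
    have "app (mat_adjoint A) w t = 0" if t: "t < n" for t
    proof -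
      have lt: "Suc a * n + t < N" unfolding N_def by (rule block_index_less[OF a t])
      have Tidx: "T $$ (b * n + r, Suc a * n + t) = (if b = a then A $$ (r, t) else 0)" if "b < m" "r < n" for b r
        using that A a t lt block_index_less[OF that] unfolding T_def N_def
        by (simp add: kron_index del: mult_Suc)
      have "app Ts x (Suc a * n + t) = (\<Sum>j<m * n. cnj (T $$ (j, Suc a * n + t)) * x j)"
        using lt T by (simp add: app_def N_def)
      also have "\<dots> = (\<Sum>b<m. \<Sum>r<n. cnj (T $$ (b * n + r, Suc a * n + t)) * x (b * n + r))"
        by (rule sum_blocks)
      also have "\<dots> = (\<Sum>b<m. if b = a then \<Sum>r<n. cnj (A $$ (r, t)) * x (a * n + r) else 0)"
        by (intro sum.cong refl) (auto simp: Tidx simp del: mult_Suc)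
      also have "\<dots> = (\<Sum>r<n. cnj (A $$ (r, t)) * x (a * n + r))" using a by simp
      also have "\<dots> = app (mat_adjoint A) w t"
        using t A by (auto simp: app_def w_def intro!: sum.cong)
      finally show ?thesis using z[OF t] by simp
    qed
    then have "app (mat_adjoint A) w = 0"
      using A by (auto simp: fun_eq_iff app_def)
    \<comment> \<open>The adjoint of a right inverse of \<open>A\<close> is a left inverse of the
      adjoint of \<open>A\<close>.\<close>
    then have "app (mat_adjoint A' * mat_adjoint A) w = 0"
      using A A' by (subst app_mult[of _ n n _ n]) auto
    then have "w = 0"
      using app_one[OF w] mat_adjoint_mult[OF A A'(1)] A'(2) by (simp add: mat_adjoint_one)
    then have "w s = 0" by (simp only: zero_fun_apply)
    then show ?thesis using s by (simp add: w_def)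
  qed
  have split: "\<exists>a s. i = a * n + s \<and> s < n \<and> a < b" if "i < b * n" for i b
  proof (intro exI conjI)
    have n0: "0 < n" using that by (auto intro: gr0I)
    show "i = i div n * n + i mod n" by simp
    show "i mod n < n" using n0 by simp
    show "i div n < b" using that by (rule less_mult_imp_div_less)
  qed
  have KerE: "Ker = {x \<in> vecs N. \<forall>i<(m - 1) * n. x i = 0}"
  proof (intro equalityI subsetI)
    fix x assume x: "x \<in> Ker"
    have "x i = 0" if i: "i < (m - 1) * n" for i
    proof -
      obtain a s where "i = a * n + s" "s < n" "a < m - 1" using split[OF i] by blast
      then show ?thesis using x block[of a x s] unfolding Ker_def by auto
    qed
    then show "x \<in> {x \<in> vecs N. \<forall>i<(m - 1) * n. x i = 0}" using x Ker_vecs by blast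
  next
    fix x assume x: "x \<in> {x \<in> vecs N. \<forall>i<(m - 1) * n. x i = 0}"
    have "app Ts x i = 0" for i
    proof (cases "i < N")
      case True
      have "cnj (T $$ (j, i)) * x j = 0" if j: "j < N" for j
      proof (cases "T $$ (j, i) = 0")
        case False
        then have "Suc (j div n) = i div n" using graded[OF j True] by simp
        moreover have "i div n < m" using True unfolding N_def by (simp add: less_mult_imp_div_less)
        ultimately have "j div n < m - 1" by simp
        moreover have "0 < n" using True unfolding N_def by (auto intro: gr0I)
        ultimately have "j < (m - 1) * n" by (simp add: div_less_iff_less_mult)
        then show ?thesis using x by simp
      qed simp
      then have "(\<Sum>j<N. cnj (T $$ (j, i)) * x j) = 0" by (intro sum.neutral) blast
      then show ?thesis using True T by (simp add: app_def)
    qed (use T in \<open>simp add: app_def\<close>)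
    then have "app Ts x = 0" by (auto simp: fun_eq_iff)
    then show "x \<in> Ker" using x unfolding Ker_def by blast
  qed
  have LE: "L = vecs N'"
  proof (intro equalityI subsetI)
    fix x assume x: "x \<in> L"
    have unitK: "unit_fun i \<in> Ker" if "(m - 1) * n \<le> i" "i < N" for i
      unfolding KerE using that by (auto simp: unit_fun_def[abs_def] vecs_def)
    have last: "x i = 0" if i: "(m - 1) * n \<le> i" "i < N" for i
      using Ker_L_orthogonal[OF unitK[OF i] x] i by simp
    \<comment> \<open>The unit vectors of the last block lie in \<open>Ker\<close>, so orthogonality
      to \<open>T\<close> of them reads off these coordinates of \<open>app Ts x\<close>.\<close>
    have Tsx: "app Ts x i = 0" if i: "(m - 1) * n \<le> i" "i < N" for i
    proof -
      have "ip N (unit_fun i) (app Ts x) = 0"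
        unfolding ip_Ts using x unitK[OF i] unfolding L_def by blast
      then show ?thesis using i by simp
    qed
    have sm: "Suc (m - 2) = m - 1" using m by simp
    \<comment> \<open>Vanishing of the last block of \<open>app Ts x\<close> forces block
      \<open>m - 2\<close> of \<open>x\<close>, the one before the last, to vanish.\<close>
    have mid: "x ((m - 2) * n + s) = 0" if "s < n" for s
    proof (rule block[OF _ _ that])
      show "Suc (m - 2) < m" using m by simp
      show "app Ts x (Suc (m - 2) * n + t) = 0" if "t < n" for t
        unfolding sm by (rule Tsx) (use block_index_less[of "m - 1" m t n] that m in \<open>auto simp: N_def\<close>)
    qed
    have "x i = 0" if i: "N' \<le> i" for i
    proof (cases "i < N")
      case True
      show ?thesis
      proof (cases "(m - 1) * n \<le> i")
        case False
        have "(m - 1) * n = (m - 2) * n + n" unfolding sm[symmetric] by simp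
        then have "i - N' < n" "i = (m - 2) * n + (i - N')" using False i unfolding N'_def by auto
        then show ?thesis using mid by metis
      qed (use last True in blast)
    qed (use x L_vecs in \<open>auto simp: vecs_def\<close>)
    then show "x \<in> vecs N'" by (simp add: vecs_def)
  next
    fix x assume x: "x \<in> vecs N'"
    have "ip N \<kappa> x = 0" "ip N (app T \<kappa>) x = 0" if k: "\<kappa> \<in> Ker" for \<kappa>
    proof -
      have "cnj (\<kappa> i) * x i = 0" for i
        using x k le(1) unfolding KerE by (cases "i < N'") (auto simp: vecs_def)
      then show "ip N \<kappa> x = 0" unfolding ip_def by simp
      \<comment> \<open>As \<open>\<kappa>\<close> is supported on block \<open>m - 1\<close>, its
        image is supported on block \<open>m - 2\<close>, which starts at index
        \<open>N'\<close>.\<close>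
      have "app T \<kappa> i = 0" if i: "i < N'" for i
      proof -
        have "T $$ (i, j) * \<kappa> j = 0" if j: "j < N" for j
        proof (cases "T $$ (i, j) = 0")
          case False
          then have "j div n = Suc (i div n)" using graded[OF _ j, of i] i le(3) by simp
          moreover have "i div n < m - 2" using i unfolding N'_def by (simp add: less_mult_imp_div_less)
          ultimately have "j div n < m - 1" by simp
          moreover have "0 < n" using i unfolding N'_def by (auto intro: gr0I)
          ultimately have "j < (m - 1) * n" by (simp add: div_less_iff_less_mult)
          then show ?thesis using k unfolding KerE by simp
        qed simp
        then have "(\<Sum>j<N. T $$ (i, j) * \<kappa> j) = 0" by (intro sum.neutral) blast
        then show ?thesis using i le(3) T by (simp add: app_def)
      qed
      then have "cnj (app T \<kappa> i) * x i = 0" for i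
        using x by (cases "i < N'") (auto simp: vecs_def)
      then show "ip N (app T \<kappa>) x = 0" unfolding ip_def by simp
    qed
    moreover have "x \<in> vecs N" using x le(3) by (auto simp: vecs_def)
    ultimately show "x \<in> L" unfolding L_def by blast
  qed
  have "N - (m - 1) * n = n" unfolding N_def using m0 by (cases m) auto
  then have dimKer: "fv.dim Ker = n" unfolding KerE by (subst dim_vecs_tail[OF le(2)])
  have hfH: "hf x y = ip N x (app H y)" for x y unfolding Heq by (rule hf_mat)
  have hfH': "hf x y = ip N' x (app H' y)" if "x \<in> vecs N'" "y \<in> vecs N'" for x y
    unfolding hfH by (rule ip_leading_block[OF H(1) H' le(3) entries that])
  have nn: "fv.nonneg_on hf S \<longleftrightarrow> fv.nonneg_on (\<lambda>x y. ip N' x (app H' y)) S" if "S \<subseteq> vecs N'" for S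
    using hfH' that unfolding fv.nonneg_on_def by (metis subsetD)
  show ?thesis
  proof (rule le_antisym)
    obtain S where S: "fv.subspace S" "S \<subseteq> vecs N" "fv.nonneg_on hf S" "fv.dim S = num_nonneg_eigenvalues H"
      using num_nonneg_eigenvalues_nonneg_dim(1)[OF H] unfolding nonneg_dim_def hfH[symmetric] by auto
    obtain S1 where S1: "fv.subspace S1" "S1 \<subseteq> L" "fv.nonneg_on hf S1" "fv.dim S \<le> fv.dim S1 + fv.dim Ker"
      using nonneg_reduce_to_L[OF S(1-3)] by metis
    have "nonneg_dim N' H' (fv.dim S1)"
      unfolding nonneg_dim_def using S1 nn[of S1] LE by blast
    then have "fv.dim S1 \<le> num_nonneg_eigenvalues H'"
      by (rule num_nonneg_eigenvalues_nonneg_dim(2)[OF H' Hh'])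
    then show "num_nonneg_eigenvalues H \<le> n + num_nonneg_eigenvalues H'"
      using S(4) S1(4) dimKer by simp
    obtain S' where S': "fv.subspace S'" "S' \<subseteq> vecs N'" "fv.nonneg_on (\<lambda>x y. ip N' x (app H' y)) S'"
      "fv.dim S' = num_nonneg_eigenvalues H'"
      using num_nonneg_eigenvalues_nonneg_dim(1)[OF H' Hh'] unfolding nonneg_dim_def by auto
    have S'L: "S' \<subseteq> L" "fv.nonneg_on hf S'" using S' nn LE by auto
    have "nonneg_dim N H (n + num_nonneg_eigenvalues H')"
      unfolding nonneg_dim_def hfH[symmetric]
      using nonneg_extend_by_Ker[OF S'(1) S'L] dimKer S'(4)
      by (intro exI[of _ "fv.span (Ker \<union> S')"]) simp
    then show "n + num_nonneg_eigenvalues H' \<le> num_nonneg_eigenvalues H"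
      by (rule num_nonneg_eigenvalues_nonneg_dim(2)[OF H])
  qed
qed

theorem theorem4p15:
  fixes m n :: nat and A :: "complex mat"
  assumes "m \<ge> 3" and "A \<in> carrier_mat n n"
  shows "(zero_dilation_index (kms m A) = num_nonneg_eigenvalues (re_mat (kms m A)) \<and>
          num_nonneg_eigenvalues (re_mat (kms m A)) =
            num_nonneg_eigenvalues
              (2 \<cdot>\<^sub>m re_mat (kron (jordan_block m 0) A)
               - 2 \<cdot>\<^sub>m kron (diag_block_mat [1\<^sub>m (m - 1), 0\<^sub>m 1 1]) (A * mat_adjoint A))) \<and>
         (invertible_mat A \<longrightarrow>
          zero_dilation_index (kms m A) =
            n + num_nonneg_eigenvalues
              (2 \<cdot>\<^sub>m re_mat (kron (jordan_block (m - 2) 0) A)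
               - 2 \<cdot>\<^sub>m kron (1\<^sub>m (m - 2)) (A * mat_adjoint A)))"
proof -
  have m: "0 < m" "2 \<le> m" using assms(1) by auto
  show ?thesis
    using zero_dilation_index_kms(1,2)[OF assms(2) m(1)]
      num_nonneg_eigenvalues_kms_invertible[OF assms(2) _ m(2)] by simp
qed

end
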